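(* Every minimally $\frac{3}{2}$-tough claw-free graph has a vertex of degree $3$.
   Context: All graphs are finite, simple and undirected. For a graph $G$ and $S\subseteq V(G)$, $w(G-S)$ denotes the number of connected components of $G-S$. The toughness of a noncomplete graph $G$ is $\tau(G)=\min\left\{\frac{|S|}{w(G-S)} : S\subseteq V(G),\ w(G-S)\ge 2\right\}$, and $\tau(G)=+\infty$ if $G$ is complete. A graph $G$ is minimally $t$-tough if $\tau(G)=t$ and $\tau(G-e)<t$ for every edge $e\in E(G)$, where $G-e$ is $G$ with the edge $e$ deleted. A graph is claw-free if it has no induced subgraph isomorphic to $K_{1,3}$. *)

theory Defs
  imports Complex_Main "HOL-Library.Extended_Real"
begin

type_synonym 'a ugraph = "'a set \<times> 'a set set"

abbreviation gverts :: "'a ugraph \<Rightarrow> 'a set" where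
  "gverts G \<equiv> fst G"

abbreviation gedges :: "'a ugraph \<Rightarrow> 'a set set" where
  "gedges G \<equiv> snd G"

definition simple_graph :: "'a ugraph \<Rightarrow> bool" where
  "simple_graph G \<longleftrightarrow> finite (gverts G) \<and> (\<forall>e\<in>gedges G. e \<subseteq> gverts G \<and> card e = 2)"

definition complete_graph :: "'a ugraph \<Rightarrow> bool" where
  "complete_graph G \<longleftrightarrow> (\<forall>u\<in>gverts G. \<forall>v\<in>gverts G. u \<noteq> v \<longrightarrow> {u, v} \<in> gedges G)"

definition vertex_degree :: "'a ugraph \<Rightarrow> 'a \<Rightarrow> nat" where
  "vertex_degree G v = card {e \<in> gedges G. v \<in> e}"

definition induced_subgraph :: "'a ugraph \<Rightarrow> 'a set \<Rightarrow> 'a ugraph" where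
  "induced_subgraph G U = (U, {e \<in> gedges G. e \<subseteq> U})"

definition delete_verts :: "'a ugraph \<Rightarrow> 'a set \<Rightarrow> 'a ugraph" where
  "delete_verts G S = induced_subgraph G (gverts G - S)"

definition delete_edge :: "'a ugraph \<Rightarrow> 'a set \<Rightarrow> 'a ugraph" where
  "delete_edge G e = (gverts G, gedges G - {e})"

definition connected_rel :: "'a ugraph \<Rightarrow> ('a \<times> 'a) set" where
  "connected_rel G = {(u, v). u \<in> gverts G \<and> v \<in> gverts G \<and> (u, v) \<in> {(x, y). {x, y} \<in> gedges G}\<^sup>*}"

text \<open>Components are represented by their vertex sets.\<close>

definition graph_components :: "'a ugraph \<Rightarrow> 'a set set" where
  "graph_components G = gverts G // connected_rel G"

definition num_components :: "'a ugraph \<Rightarrow> nat" where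
  "num_components G = card (graph_components G)"

text \<open>For a finite noncomplete graph the set under the minimum is finite and nonempty: removing
  all vertices but two nonadjacent ones leaves two components.\<close>

definition toughness :: "'a ugraph \<Rightarrow> ereal" where
  "toughness G =
    (if complete_graph G then \<infinity>
     else Min {ereal (real (card S) / real (num_components (delete_verts G S))) | S.
                 S \<subseteq> gverts G \<and> num_components (delete_verts G S) \<ge> 2})"

definition minimally_tough :: "real \<Rightarrow> 'a ugraph \<Rightarrow> bool" where
  "minimally_tough t G \<longleftrightarrow>
     toughness G = ereal t \<and> (\<forall>e\<in>gedges G. toughness (delete_edge G e) < ereal t)"

definition graph_isomorphic :: "'a ugraph \<Rightarrow> 'b ugraph \<Rightarrow> bool" where
  "graph_isomorphic G H \<longleftrightarrow>
     (\<exists>f. bij_betw f (gverts G) (gverts H) \<and>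
          (\<forall>u\<in>gverts G. \<forall>v\<in>gverts G. {u, v} \<in> gedges G \<longleftrightarrow> {f u, f v} \<in> gedges H))"

definition complete_bipartite :: "nat \<Rightarrow> nat \<Rightarrow> (nat + nat) ugraph" where
  "complete_bipartite m n =
     (Inl ` {..<m} \<union> Inr ` {..<n}, {{Inl i, Inr j} | i j. i < m \<and> j < n})"

definition claw_free :: "'a ugraph \<Rightarrow> bool" where
  "claw_free G \<longleftrightarrow>
     \<not> (\<exists>U \<subseteq> gverts G. graph_isomorphic (induced_subgraph G U) (complete_bipartite 1 3))"

end

theory Submission
  imports Defs "HOL-Library.Disjoint_Sets"
begin

text \<open>Toughness 3/2 makes \<open>G\<close> 3-connected, and a set attaining it yields a cut of size 3. Suppose that all
  degrees are at least 4, and let \<open>F\<close> be a smallest fragment, i.e. a smallest set with three neighbours and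
  nonempty remainder. By Mader's theorem no 3-cut meets \<open>F\<close>. Each edge \<open>uv\<close> is a bridge of \<open>G - S\<close> for
  some \<open>S\<close> violating 3/2-toughness of \<open>G - uv\<close>; since a vertex of \<open>S\<close> sees at most two components of \<open>G - S\<close>
  and every component sees at least three vertices of \<open>S\<close>, a double count leaves slack at most 2. If \<open>u\<close> is
  in \<open>F\<close>, then, unless \<open>F = {u, v}\<close>, this forces \<open>{u, v}\<close> to be the component containing \<open>uv\<close>, with exactly
  four neighbours. If \<open>F\<close> has at least three vertices, this local information makes \<open>F\<close> closed under
  adjacency, which is impossible. If \<open>F\<close> has two vertices, an edge inside \<open>N F\<close> cannot be critical.\<close>

subsection \<open>Fragments and atoms\<close>

locale claw_free_graph =
  fixes V :: "'a set" and E :: "'a set set"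
  assumes finite_V: "finite V"
    and edges: "e \<in> E \<Longrightarrow> e \<subseteq> V \<and> card e = 2"
    and no_claw: "\<lbrakk>{a, b} \<in> E; {a, c} \<in> E; {a, d} \<in> E; b \<noteq> c; b \<noteq> d; c \<noteq> d\<rbrakk>
      \<Longrightarrow> {b, c} \<in> E \<or> {b, d} \<in> E \<or> {c, d} \<in> E"
begin

lemma adj_sym: "{x, y} \<in> E \<Longrightarrow> {y, x} \<in> E"
  by (simp add: insert_commute)

lemma adjD: "{x, y} \<in> E \<Longrightarrow> x \<in> V \<and> y \<in> V \<and> x \<noteq> y"
  using edges[of "{x, y}"] by auto

definition N :: "'a set \<Rightarrow> 'a set" where
  "N X = {y \<in> V - X. \<exists>x\<in>X. {x, y} \<in> E}"

lemma N_subset: "N X \<subseteq> V - X"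
  by (auto simp: N_def)

lemma finite_N [simp]: "finite (N X)"
  using finite_V by (simp add: N_def)

lemma in_N_iff: "y \<in> N X \<longleftrightarrow> y \<notin> X \<and> (\<exists>x\<in>X. {x, y} \<in> E)"
  using adjD by (auto simp: N_def)

lemma in_N_singleton [simp]: "y \<in> N {x} \<longleftrightarrow> {x, y} \<in> E"
  using adjD by (auto simp: in_N_iff)

lemma N_subset_Un: "Y \<subseteq> Z \<Longrightarrow> N Y \<subseteq> N Z \<union> (N Y \<inter> Z)"
  unfolding N_def by blast

section \<open>Counting the parts next to a vertex\<close>

text \<open>The components of \<open>G - S\<close> are the typical instance. The counts use only
  that no edge joins different parts, so two parts may be merged into one, as is done below for the
  ends of a critical edge.\<close>

definition separated :: "'a set set \<Rightarrow> bool" where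
  "separated P \<longleftrightarrow> (\<forall>C\<in>P. \<forall>D\<in>P. C \<noteq> D \<longrightarrow> (\<forall>x\<in>C. \<forall>y\<in>D. {x, y} \<notin> E))"

text \<open>Neighbours of \<open>s\<close> in three different parts are pairwise nonadjacent, so
  they would form a claw centred at \<open>s\<close>.\<close>

lemma card_adjacent_parts_le_2:
  assumes "disjoint P" "separated P"
  shows "card {D \<in> P. s \<in> N D} \<le> 2"
proof (rule ccontr)
  assume "\<not> ?thesis"
  then have "3 \<le> card {D \<in> P. s \<in> N D}" by simp
  then obtain R where R: "R \<subseteq> {D \<in> P. s \<in> N D}" "card R = 3"
    by (rule obtain_subset_with_card_n)
  then obtain C1 C2 C3 where C: "R = {C1, C2, C3}" "C1 \<noteq> C2" "C1 \<noteq> C3" "C2 \<noteq> C3"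
    by (auto simp: card_3_iff)
  have P: "C1 \<in> P" "C2 \<in> P" "C3 \<in> P" and "s \<in> N C1" "s \<in> N C2" "s \<in> N C3"
    using R C by auto
  then obtain x1 x2 x3 where x: "x1 \<in> C1" "x2 \<in> C2" "x3 \<in> C3"
    and "{x1, s} \<in> E" "{x2, s} \<in> E" "{x3, s} \<in> E"
    by (auto simp: in_N_iff)
  then have s: "{s, x1} \<in> E" "{s, x2} \<in> E" "{s, x3} \<in> E"
    by (simp_all add: insert_commute)
  have "x1 \<noteq> x2" "x1 \<noteq> x3" "x2 \<noteq> x3"
    using x C P assms(1) unfolding pairwise_def disjnt_iff by blast+
  then have "{x1, x2} \<in> E \<or> {x1, x3} \<in> E \<or> {x2, x3} \<in> E"
    using no_claw[OF s] by blast
  then show False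
    using assms(2) x P C unfolding separated_def by blast
qed

lemma N_part_subset:
  assumes "separated P" "\<Union>P = V - S" "D \<in> P"
  shows "N D \<subseteq> S"
proof
  fix y assume y: "y \<in> N D"
  then obtain x where x: "x \<in> D" "{x, y} \<in> E" "y \<notin> D" by (auto simp: in_N_iff)
  have "y \<notin> D'" if "D' \<in> P" for D'
    using assms that x unfolding separated_def by metis
  moreover have "y \<in> V" using y N_subset by blast
  ultimately show "y \<in> S" using assms(2) by blast
qed

text \<open>Both sides count the pairs of a part and a vertex of \<open>S\<close> adjacent to
  it.\<close>

lemma sum_card_N:
  assumes "finite P" "finite S" "\<And>D. D \<in> P \<Longrightarrow> N D \<subseteq> S"
  shows "(\<Sum>D\<in>P. card (N D)) = (\<Sum>s\<in>S. card {D \<in> P. s \<in> N D})"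
proof -
  have "(\<Sum>D\<in>P. card (N D)) = (\<Sum>D\<in>P. card {s \<in> S. s \<in> N D})"
    using assms(3) by (intro sum.cong refl arg_cong[where f = card]) auto
  also have "\<dots> = (\<Sum>s\<in>S. card {D \<in> P. s \<in> N D})"
    using assms by (intro sum_multicount_gen) auto
  finally show ?thesis .
qed

text \<open>One side of a 3-cut. In a 3-connected graph these are the fragments of connectivity
  theory, and the smallest ones are the atoms.\<close>

definition fragment :: "'a set \<Rightarrow> bool" where
  "fragment X \<longleftrightarrow> X \<noteq> {} \<and> X \<subseteq> V \<and> V - X - N X \<noteq> {} \<and> card (N X) = 3"

end

text \<open>A separator contains the neighbourhood of each side that it cuts off, so a lower bound
  on such neighbourhoods expresses 3-connectedness.\<close>

locale three_connected_claw_free_graph = claw_free_graph +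
  assumes conn: "\<lbrakk>X \<subseteq> V; X \<noteq> {}; V - X - N X \<noteq> {}\<rbrakk> \<Longrightarrow> 3 \<le> card (N X)"
begin

text \<open>The vertex \<open>z\<close> keeps the remainder nonempty, so \<open>conn\<close> gives
  \<open>N X\<close> at least three elements, and a superset \<open>W\<close> with at most three
  must coincide with it. This turns small bounds on neighbourhoods into 3-cuts.\<close>

lemma N_le_3_imp_fragment:
  assumes "X \<subseteq> V" "X \<noteq> {}" "z \<in> V - X" "z \<notin> W" "N X \<subseteq> W" "finite W" "card W \<le> 3"
  shows "fragment X" "N X = W" "card W = 3"
proof -
  have ne: "V - X - N X \<noteq> {}" using assms by blast
  have "3 \<le> card (N X)" using conn assms ne by blast
  moreover have "card (N X) \<le> card W" using assms card_mono by blast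
  ultimately have *: "card (N X) = 3" "card (N X) = card W" using assms by auto
  then show "fragment X" using assms ne by (simp add: fragment_def)
  show "N X = W" using * assms card_subset_eq by metis
  show "card W = 3" using * by simp
qed

lemma N_ge_3:
  assumes "X \<subseteq> V" "X \<noteq> {}" "z \<in> V - X" "z \<notin> W" "N X \<subseteq> W" "finite W"
  shows "3 \<le> card W"
proof -
  have "V - X - N X \<noteq> {}" using assms by blast
  then show ?thesis using conn assms card_mono order_trans by metis
qed

text \<open>Double count of the adjacent pairs of a part and a vertex of \<open>S\<close>: each part
  occurs at least three times by connectivity, each vertex of \<open>S\<close> at most twice by
  claw-freeness. If equality holds, not every part can have four neighbours.\<close>

lemma separated_partition:
  assumes P: "partition_on (V - S) P" and S: "S \<subseteq> V" and sep: "separated P" and P2: "2 \<le> card P"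
  shows "3 * card P \<le> 2 * card S"
    and "2 * card S = 3 * card P \<Longrightarrow> \<exists>D. fragment D"
proof -
  have finS: "finite S" using S finite_V finite_subset by blast
  have finP: "finite P" using P finite_V by (meson finite_Diff finite_elements)
  have UP: "\<Union>P = V - S" and neP: "{} \<notin> P" and dis: "disjoint P"
    using P by (simp_all add: partition_on_def)
  have N_S: "N D \<subseteq> S" if "D \<in> P" for D by (rule N_part_subset[OF sep UP that])
  have part: "D \<subseteq> V" "D \<noteq> {}" "V - D - N D \<noteq> {}" if D: "D \<in> P" for D
  proof -
    show "D \<subseteq> V" "D \<noteq> {}" using D UP neP by blast+
    have "\<not> P \<subseteq> {D}" using P2 card_mono[of "{D}" P] by auto
    then obtain D' where D': "D' \<in> P" "D' \<noteq> D" by blast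
    then have "D' \<noteq> {}" using neP by blast
    then obtain z where z: "z \<in> D'" by blast
    then have "z \<notin> D" using D D' dis unfolding pairwise_def disjnt_iff by blast
    moreover have "z \<in> V - S" using z D' UP by blast
    ultimately show "V - D - N D \<noteq> {}" using N_S[OF D] by blast
  qed
  have ge3: "3 \<le> card (N D)" if "D \<in> P" for D using conn part[OF that] by blast
  have "(\<Sum>s\<in>S. card {D \<in> P. s \<in> N D}) \<le> (\<Sum>s\<in>S. 2)"
    by (intro sum_mono card_adjacent_parts_le_2 dis sep)
  then have le: "(\<Sum>D\<in>P. card (N D)) \<le> 2 * card S"
    using sum_card_N[OF finP finS N_S] by simp
  have "(\<Sum>D\<in>P. 3) \<le> (\<Sum>D\<in>P. card (N D))" using ge3 by (rule sum_mono)
  then show "3 * card P \<le> 2 * card S" using le by simp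
  show "\<exists>D. fragment D" if eq: "2 * card S = 3 * card P"
  proof (rule ccontr)
    assume none: "\<nexists>D. fragment D"
    have "4 \<le> card (N D)" if D: "D \<in> P" for D
    proof -
      have "\<not> fragment D" using none by blast
      then have "card (N D) \<noteq> 3" using part[OF D] by (simp add: fragment_def)
      then show ?thesis using ge3[OF D] by linarith
    qed
    then have "(\<Sum>D\<in>P. 4) \<le> (\<Sum>D\<in>P. card (N D))" by (rule sum_mono)
    then show False using le eq P2 by simp
  qed
qed

text \<open>If \<open>x\<close> is adjacent to all other vertices, \<open>conn\<close> says nothing
  about it, but \<open>X\<close> and its three neighbours already provide four vertices. Otherwise
  \<open>N {x}\<close> is a separator.\<close>

lemma card_N_vertex_ge_3:
  assumes X: "fragment X" and x: "x \<in> V"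
  shows "3 \<le> card (N {x})"
proof (cases "V - {x} - N {x} = {}")
  case True
  have "X \<noteq> {}" "card (N X) = 3" and fin: "finite X"
    using X finite_V finite_subset by (auto simp: fragment_def)
  then have "1 \<le> card X" by (simp add: Suc_le_eq card_gt_0_iff)
  moreover have "X \<inter> N X = {}" using N_subset by blast
  ultimately have "4 \<le> card (X \<union> N X)"
    using fin \<open>card (N X) = 3\<close> by (simp add: card_Un_disjoint)
  also have "\<dots> \<le> card (insert x (N {x}))"
    using True X N_subset[of X] by (intro card_mono) (auto simp: fragment_def)
  finally show ?thesis by (simp add: card_insert_if split: if_splits)
next
  case False
  then show ?thesis using conn[of "{x}"] x by blast
qed

lemma N_compl_subset: "N (V - X - N X) \<subseteq> N X"
proof
  fix y assume "y \<in> N (V - X - N X)"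
  then obtain x where "x \<in> V - X - N X" "y \<notin> V - X - N X" "{x, y} \<in> E"
    unfolding in_N_iff by blast
  then show "y \<in> N X"
    using adjD[of x y] adj_sym[of x y] in_N_iff by blast
qed

text \<open>The neighbourhood of the far side lies in the cut \<open>N X\<close>, and a vertex of
  \<open>X\<close> remains beyond it, so 3-connectedness forces equality.\<close>

lemma fragment_compl:
  assumes "fragment X"
  shows "fragment (V - X - N X)" "N (V - X - N X) = N X"
proof -
  obtain z where z: "z \<in> X" using assms by (auto simp: fragment_def)
  have sub: "X \<subseteq> V" using assms by (auto simp: fragment_def)
  have *: "z \<in> V - (V - X - N X)" "z \<notin> N X" "card (N X) \<le> 3" "V - X - N X \<noteq> {}"
    using z sub assms by (auto simp: fragment_def in_N_iff)
  show "fragment (V - X - N X)" "N (V - X - N X) = N X"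
    using N_le_3_imp_fragment[of "V - X - N X" z "N X"] N_compl_subset[of X] * by auto
qed

end

text \<open>A counterexample has no vertex of degree 3, hence minimum degree at least 4.\<close>

locale atom_graph = three_connected_claw_free_graph +
  fixes F :: "'a set"
  assumes frag: "fragment F"
    and min_frag: "fragment X \<Longrightarrow> card F \<le> card X"
    and deg4: "x \<in> V \<Longrightarrow> 4 \<le> card (N {x})"
begin

lemma F_sub: "F \<subseteq> V" and F_ne: "F \<noteq> {}" and card_NF: "card (N F) = 3"
  using frag by (auto simp: fragment_def)

lemma finite_F: "finite F"
  using F_sub finite_V finite_subset by blast

text \<open>The vertex of a singleton fragment would have degree 3.\<close>

lemma two_le_card_F: "2 \<le> card F"
proof (rule ccontr)
  assume "\<not> ?thesis"
  moreover have "card F \<noteq> 0" using F_ne finite_F by simp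
  ultimately have "card F = 1" by simp
  then obtain x where "F = {x}" by (auto simp: card_1_singleton_iff)
  then show False using card_NF F_sub deg4[of x] by auto
qed

definition F' :: "'a set" where "F' = V - F - N F"

lemma F'_ne: "F' \<noteq> {}"
  using frag by (auto simp: F'_def fragment_def)

lemma no_edge_F_F': "x \<in> F \<Longrightarrow> y \<in> F' \<Longrightarrow> {x, y} \<notin> E"
  unfolding F'_def using in_N_iff by blast

lemma N_F': "N F' = N F"
  using fragment_compl(2)[OF frag] by (simp add: F'_def)

text \<open>Mader's theorem on atoms, for connectivity 3: a minimum cut that meets an atom contains it,
  and the atom then has at most \<open>3 / 2\<close> vertices. Of the nine cells cut out by \<open>F, N F, F'\<close> and
  \<open>X, N X, X'\<close>, the neighbourhood of a corner cell lies in the three cells next to it.\<close>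

lemma fragment_avoids_F:
  assumes X: "fragment X"
  shows "N X \<inter> F = {}"
proof (rule ccontr)
  assume meets: "N X \<inter> F \<noteq> {}"
  define X' where "X' = V - X - N X"
  have fX': "fragment X'" and NX': "N X' = N X"
    using fragment_compl[OF X] by (auto simp: X'_def)
  have fF': "fragment F'"
    using fragment_compl(1)[OF frag] by (simp add: F'_def)
  have cX: "card F \<le> card X" "card F \<le> card X'" "card F \<le> card F'"
    using min_frag X fX' fF' by auto
  have card3: "card Y = card (Y \<inter> X) + card (Y \<inter> N X) + card (Y \<inter> X')" if "Y \<subseteq> V" for Y
  proof -
    have fin: "finite Y" using that finite_V finite_subset by blast
    have "Y = (Y \<inter> X \<union> Y \<inter> N X) \<union> Y \<inter> X'" using that by (auto simp: X'_def)
    then have "card Y = card (Y \<inter> X \<union> Y \<inter> N X) + card (Y \<inter> X')"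
      using fin N_subset[of X] card_Un_disjoint[of "Y \<inter> X \<union> Y \<inter> N X" "Y \<inter> X'"]
      by (auto simp: X'_def)
    also have "card (Y \<inter> X \<union> Y \<inter> N X) = card (Y \<inter> X) + card (Y \<inter> N X)"
      using fin N_subset[of X] by (intro card_Un_disjoint) auto
    finally show ?thesis .
  qed
  have card3': "card Y = card (F \<inter> Y) + card (N F \<inter> Y) + card (F' \<inter> Y)" if "Y \<subseteq> V" for Y
  proof -
    have fin: "finite Y" using that finite_V finite_subset by blast
    have "Y = (F \<inter> Y \<union> N F \<inter> Y) \<union> F' \<inter> Y" using that by (auto simp: F'_def)
    then have "card Y = card (F \<inter> Y \<union> N F \<inter> Y) + card (F' \<inter> Y)"
      using fin N_subset[of F] card_Un_disjoint[of "F \<inter> Y \<union> N F \<inter> Y" "F' \<inter> Y"]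
      by (auto simp: F'_def)
    also have "card (F \<inter> Y \<union> N F \<inter> Y) = card (F \<inter> Y) + card (N F \<inter> Y)"
      using fin N_subset[of F] by (intro card_Un_disjoint) auto
    finally show ?thesis .
  qed
  define f m f' where "f = card (F \<inter> N X)" and "m = card (N F \<inter> N X)" and "f' = card (F' \<inter> N X)"
  have sumX: "f + m + f' = 3"
    using card3'[of "N X"] N_subset[of X] X by (auto simp: f_def m_def f'_def fragment_def)
  have sumF: "card (N F \<inter> X) + m + card (N F \<inter> X') = 3"
    using card3[of "N F"] N_subset[of F] card_NF by (auto simp: m_def)
  have subs: "X \<subseteq> V" "X' \<subseteq> V" "F' \<subseteq> V" "X \<inter> N X = {}" "X' \<inter> N X = {}" "X \<inter> X' = {}"
    using X N_subset[of X] by (auto simp: X'_def F'_def fragment_def)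
  have corner: "N (A \<inter> Z) \<subseteq> (A \<inter> N X) \<union> (N F \<inter> N X) \<union> (N F \<inter> Z)"
    if "A = F \<or> A = F'" "Z = X \<or> Z = X'" for A Z
  proof -
    have "N A = N F" "N Z = N X" using that N_F' NX' by auto
    then show ?thesis
      using in_N_iff[of _ "A \<inter> Z"] in_N_iff[of _ A] in_N_iff[of _ Z] by blast
  qed
  have corner_card: "card ((A \<inter> N X) \<union> (N F \<inter> N X) \<union> (N F \<inter> Z))
      \<le> card (A \<inter> N X) + m + card (N F \<inter> Z)" for A Z
    using card_Un_le[of "(A \<inter> N X) \<union> (N F \<inter> N X)" "N F \<inter> Z"]
      card_Un_le[of "A \<inter> N X" "N F \<inter> N X"] by (simp add: m_def)
  \<comment> \<open>With at most three, the corner would be a fragment. It is a proper subset of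
    \<open>F\<close> because \<open>F\<close> meets \<open>N X\<close>, which contradicts
    minimality.\<close>
  have F_corner: "card (F \<inter> N X) + m + card (N F \<inter> Z) \<ge> 4"
    if Z: "Z = X \<or> Z = X'" and "F \<inter> Z \<noteq> {}" for Z
  proof (rule ccontr)
    assume "\<not> ?thesis"
    then have le: "card ((F \<inter> N X) \<union> (N F \<inter> N X) \<union> (N F \<inter> Z)) \<le> 3"
      using corner_card[of F Z] by linarith
    obtain z where z: "z \<in> F'" using F'_ne by blast
    have "fragment (F \<inter> Z)"
      using le that z corner[of F Z] F_sub
      by (intro N_le_3_imp_fragment(1)[where z = z and W = "(F \<inter> N X) \<union> (N F \<inter> N X) \<union> (N F \<inter> Z)"])
        (auto simp: F'_def)
    then have "card F \<le> card (F \<inter> Z)" by (rule min_frag)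
    moreover have "F \<inter> Z \<subset> F" using meets Z subs by blast
    ultimately show False using finite_F psubset_card_mono by (metis leD)
  qed
  \<comment> \<open>Minimality of \<open>F\<close> gives nothing here, so the bound is 3, from
    connectivity alone.\<close>
  have F'_corner: "card (F' \<inter> N X) + m + card (N F \<inter> Z) \<ge> 3"
    if Z: "Z = X \<or> Z = X'" and "F' \<inter> Z \<noteq> {}" for Z
  proof -
    obtain z where z: "z \<in> F" using F_ne by blast
    have "3 \<le> card ((F' \<inter> N X) \<union> (N F \<inter> N X) \<union> (N F \<inter> Z))"
      using that z corner[of F' Z] subs F_sub N_subset[of F]
      by (intro N_ge_3[where X = "F' \<inter> Z" and z = z]) (auto simp: F'_def)
    then show ?thesis using corner_card[of F' Z] by linarith
  qed
  have T_sub: "card Z = card (N F \<inter> Z)" if "F \<inter> Z = {}" "F' \<inter> Z = {}" "Z \<subseteq> V" for Z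
    using card3'[of Z] that by simp
  have FF: "card F = card (F \<inter> X) + f + card (F \<inter> X')"
    using card3[of F] F_sub by (simp add: f_def)
  have FF': "card F' = card (F' \<inter> X) + f' + card (F' \<inter> X')"
    using card3[of F'] subs by (simp add: f'_def)
  \<comment> \<open>For opposite nonempty corners the bounds 4 and 3 add up to 7, while the cells
    involved are those of the two cuts \<open>N X\<close> and \<open>N F\<close>, 6 in
    total.\<close>
  have opp: "F' \<inter> X' = {}" if "F \<inter> X \<noteq> {}"
    using F_corner[of X] F'_corner[of X'] that sumX sumF by (auto simp: f_def f'_def)
  have opp': "F' \<inter> X = {}" if "F \<inter> X' \<noteq> {}"
    using F_corner[of X'] F'_corner[of X] that sumX sumF by (auto simp: f_def f'_def)
  consider "F \<inter> X \<noteq> {}" "F \<inter> X' \<noteq> {}" | "F \<inter> X \<noteq> {}" "F \<inter> X' = {}"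
    | "F \<inter> X = {}" "F \<inter> X' \<noteq> {}" | "F \<inter> X = {}" "F \<inter> X' = {}"
    by blast
  then show False
  proof cases
    case 1
    \<comment> \<open>Now \<open>F'\<close> lies inside \<open>N X\<close>, so
      \<open>f' \<ge> card F \<ge> f + 2\<close> and hence \<open>2 * f + m \<le> 1\<close>, whereas
      the two corner bounds give \<open>2 * f + m \<ge> 5\<close>.\<close>
    then have "card F' = f'" using FF' opp opp' by simp
    moreover have "card (F \<inter> X) \<ge> 1" "card (F \<inter> X') \<ge> 1"
      using 1 finite_F by (simp_all add: Suc_leI card_gt_0_iff)
    ultimately show False
      using F_corner[of X] F_corner[of X'] 1 FF cX sumX sumF unfolding f_def f'_def by simp
  next
    case 2
    \<comment> \<open>Now \<open>X'\<close> lies inside \<open>N F\<close>. The corner bound gives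
      \<open>f > card X'\<close>, but \<open>card X' \<ge> card F \<ge> f\<close>.\<close>
    then have "card X' = card (N F \<inter> X')" using T_sub opp subs by blast
    then show False using F_corner[of X] 2 FF cX sumX sumF unfolding f_def by simp
  next
    case 3
    then have "card X = card (N F \<inter> X)" using T_sub opp' subs by blast
    then show False using F_corner[of X'] 3 FF cX sumX sumF unfolding f_def by simp
  next
    case 4
    \<comment> \<open>Here \<open>F\<close> lies inside \<open>N X\<close>, so
      \<open>f \<ge> 2\<close> and \<open>f' + m \<le> 1\<close>. Two such bounds exceed the three
      elements of \<open>N F\<close>.\<close>
    have "card (N F \<inter> Z) \<ge> 2" if Z: "Z = X \<or> Z = X'" for Z
    proof (cases "F' \<inter> Z = {}")
      case True
      then have "card Z = card (N F \<inter> Z)" using T_sub 4 Z subs by blast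
      then show ?thesis using cX Z two_le_card_F by auto
    next
      case False
      then show ?thesis using F'_corner[OF Z] 4 FF two_le_card_F sumX unfolding f'_def by simp
    qed
    from this[of X] this[of X'] show False using sumF by simp
  qed
qed

text \<open>In effect \<open>F\<close> is connected: a proper part without neighbours in the rest of
  \<open>F\<close> has its neighbourhood inside \<open>N F\<close> and would be a smaller
  fragment.\<close>

lemma N_meets_F:
  assumes "Y \<subseteq> F" "Y \<noteq> {}" "Y \<noteq> F"
  shows "N Y \<inter> F \<noteq> {}"
proof
  assume a: "N Y \<inter> F = {}"
  obtain z where "z \<in> F'" using F'_ne by blast
  moreover have "N Y \<subseteq> N F" using N_subset_Un[OF assms(1)] a by simp
  ultimately have "fragment Y"
    using assms F_sub card_NF
    by (intro N_le_3_imp_fragment(1)[where z = z and W = "N F"]) (auto simp: F'_def)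
  then have "card F \<le> card Y" by (rule min_frag)
  moreover have "Y \<subset> F" using assms by blast
  ultimately show False using finite_F psubset_card_mono by (metis leD)
qed

end

subsection \<open>Critical edges\<close>

text \<open>\<open>crit\<close> is toughness below 3/2 for \<open>G - uv\<close> with denominators
  cleared. The parts \<open>P\<close> stand for the components of \<open>G - uv - S\<close>; in
  \<open>G\<close> itself only \<open>uv\<close> can join two of them.\<close>

locale critical_atom_graph = atom_graph +
  assumes crit: "{u, v} \<in> E \<Longrightarrow> \<exists>S P. S \<subseteq> V \<and> partition_on (V - S) P \<and> 2 \<le> card P \<and>
    2 * card S < 3 * card P \<and>
    (\<forall>C\<in>P. \<forall>D\<in>P. C \<noteq> D \<longrightarrow> (\<forall>x\<in>C. \<forall>y\<in>D. {x, y} \<in> E \<longrightarrow> {x, y} = {u, v}))"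
begin

text \<open>The tuple describes a set \<open>S\<close> witnessing that \<open>G - uv\<close> is less than 3/2-tough: \<open>C1\<close> and \<open>C2\<close> are
  the parts of \<open>G - uv - S\<close> joined by \<open>uv\<close>. The vertices of \<open>S\<close> with neighbours in both are split into
  those with neighbours in no third part (\<open>A\<close>) and the others (\<open>B\<close>); \<open>X1\<close> and \<open>X2\<close> consist of the vertices
  of \<open>S\<close> with neighbours in only one of \<open>C1\<close>, \<open>C2\<close>. By claw-freeness a vertex of \<open>B\<close> has no neighbour in \<open>C1\<close>
  other than \<open>u\<close>. The bound 5 is the slack of the double count of pairs (vertex of \<open>S\<close>, adjacent part of
  \<open>G - S\<close>); equality forces all other parts to have exactly three neighbours.\<close>

definition edge_split ::
    "'a \<Rightarrow> 'a \<Rightarrow> 'a set \<Rightarrow> 'a set \<Rightarrow> 'a set \<Rightarrow> 'a set \<Rightarrow> 'a set \<Rightarrow> 'a set \<Rightarrow> 'a set \<Rightarrow> bool" where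
  "edge_split u v S C1 C2 A B X1 X2 \<longleftrightarrow>
    S \<subseteq> V \<and> C1 \<subseteq> V - S \<and> C2 \<subseteq> V - S \<and> C1 \<inter> C2 = {} \<and> u \<in> C1 \<and> v \<in> C2 \<and>
    A \<subseteq> S \<and> B \<subseteq> S \<and> X1 \<subseteq> S \<and> X2 \<subseteq> S \<and>
    A \<inter> B = {} \<and> A \<inter> X1 = {} \<and> A \<inter> X2 = {} \<and> B \<inter> X1 = {} \<and> B \<inter> X2 = {} \<and> X1 \<inter> X2 = {} \<and>
    N C1 = insert v (A \<union> B \<union> X1) \<and> N C2 = insert u (A \<union> B \<union> X2) \<and>
    N (C1 - {u}) \<subseteq> insert u (A \<union> X1) \<and> N (C2 - {v}) \<subseteq> insert v (A \<union> X2) \<and>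
    2 * card A + card B + card X1 + card X2 \<le> 5 \<and>
    (2 * card A + card B + card X1 + card X2 = 5 \<longrightarrow> (\<forall>s\<in>S - A. \<exists>D. fragment D \<and> s \<in> N D)) \<and>
    (\<forall>b\<in>B. \<exists>x\<in>V - S - (C1 \<union> C2). {b, x} \<in> E)"

lemma edge_split_sym: "edge_split u v S C1 C2 A B X1 X2 \<Longrightarrow> edge_split v u S C2 C1 A B X2 X1"
  unfolding edge_split_def by (simp add: Int_commute Un_commute add_ac)

text \<open>The first claim holds because \<open>uv\<close> is the only edge between parts. For the
  second, take a vertex of \<open>S\<close> with neighbours in \<open>C1 - {u}\<close>, in
  \<open>C2\<close> and in a third part: none of these neighbours can be joined by
  \<open>uv\<close>, so they form a claw.\<close>

lemma split_half:
  assumes P: "partition_on (V - S) P" and C: "C1 \<in> P" "C2 \<in> P" "C1 \<noteq> C2" "u \<in> C1" "v \<in> C2"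
    and uv: "{u, v} \<in> E"
    and e: "\<And>C D x y. \<lbrakk>C \<in> P; D \<in> P; C \<noteq> D; x \<in> C; y \<in> D; {x, y} \<in> E\<rbrakk> \<Longrightarrow> {x, y} = {u, v}"
  shows "N C1 = insert v (N C1 \<inter> S)"
    and "N (C1 - {u}) \<subseteq> insert u {s \<in> N C1 \<inter> S. \<not> (s \<in> N C2 \<and> (\<exists>D\<in>P - {C1, C2}. s \<in> N D))}"
proof -
  have UP: "\<Union>P = V - S" and dis: "\<And>C D x. \<lbrakk>C \<in> P; D \<in> P; C \<noteq> D; x \<in> C\<rbrakk> \<Longrightarrow> x \<notin> D"
    using P by (auto simp: partition_on_def pairwise_def disjnt_iff)
  have N1: "y = v \<and> x = u" if "x \<in> C1" "{x, y} \<in> E" "y \<notin> C1" "y \<notin> S" for x y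
  proof -
    have "y \<in> V - S" using that adjD by blast
    then obtain D where D: "D \<in> P" "y \<in> D" using UP by blast
    then have "{x, y} = {u, v}" using e[of C1 D x y] that C by blast
    then show ?thesis using that C by (auto simp: doubleton_eq_iff)
  qed
  have "v \<in> N C1" using C uv dis[of C2 C1 v] by (auto simp: in_N_iff)
  moreover have "N C1 \<subseteq> insert v S"
    unfolding in_N_iff subset_iff using N1 by blast
  ultimately show "N C1 = insert v (N C1 \<inter> S)" by blast
  show "N (C1 - {u}) \<subseteq> insert u {s \<in> N C1 \<inter> S. \<not> (s \<in> N C2 \<and> (\<exists>D\<in>P - {C1, C2}. s \<in> N D))}"
  proof
    fix y assume y: "y \<in> N (C1 - {u})"
    then obtain x where x: "x \<in> C1" "x \<noteq> u" "{x, y} \<in> E" by (auto simp: in_N_iff)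
    show "y \<in> insert u {s \<in> N C1 \<inter> S. \<not> (s \<in> N C2 \<and> (\<exists>D\<in>P - {C1, C2}. s \<in> N D))}"
    proof (cases "y = u")
      case False
      then have yC: "y \<notin> C1" using y by (auto simp: in_N_iff)
      then have yS: "y \<in> N C1 \<inter> S" using N1[of x y] x by (auto simp: in_N_iff)
      have False if "y \<in> N C2" "D \<in> P - {C1, C2}" "y \<in> N D" for D
      proof -
        obtain z where z: "z \<in> C2" "{z, y} \<in> E"
          using \<open>y \<in> N C2\<close> by (auto simp: in_N_iff)
        obtain w where w: "w \<in> D" "{w, y} \<in> E"
          using \<open>y \<in> N D\<close> by (auto simp: in_N_iff)
        note zw = z w
        have ne: "x \<noteq> z" "x \<noteq> w" "z \<noteq> w"
          using dis[of C1 C2 x] dis[of C1 D x] dis[of C2 D z] x zw C that(2) by auto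
        have uvD: "u \<notin> D" "v \<notin> D"
          using dis[of C1 D u] dis[of C2 D v] C that(2) by auto
        consider "{x, z} \<in> E" | "{x, w} \<in> E" | "{z, w} \<in> E"
          using no_claw[of y x z w] ne x zw by (auto simp: insert_commute)
        then show False
        proof cases
          case 1
          then have "{x, z} = {u, v}" using e[of C1 C2 x z] x zw C by blast
          then show False using x zw C dis[of C2 C1] by (auto simp: doubleton_eq_iff)
        next
          case 2
          then have "{x, w} = {u, v}" using e[of C1 D x w] x zw C that by blast
          then show False using uvD zw by (auto simp: doubleton_eq_iff)
        next
          case 3
          then have "{z, w} = {u, v}" using e[of C2 D z w] x zw C that by blast
          then show False using uvD zw by (auto simp: doubleton_eq_iff)
        qed
      qed
      then show ?thesis using yS by blast
    qed simp
  qed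
qed

text \<open>Since \<open>2 * card S < 3 * card P\<close>, the family \<open>P\<close> is not
  separated in \<open>G\<close>, so \<open>uv\<close> joins two of its parts. Merging these two
  gives the separated family \<open>R\<close>, and the double count for \<open>R\<close> is compared
  with the inequality for \<open>P\<close>.\<close>

lemma ex_edge_split:
  assumes uv: "{u, v} \<in> E"
  obtains S C1 C2 A B X1 X2 where "edge_split u v S C1 C2 A B X1 X2"
proof -
  obtain S P where S: "S \<subseteq> V" and P: "partition_on (V - S) P" "2 \<le> card P"
    and small: "2 * card S < 3 * card P"
    and e: "\<And>C D x y. \<lbrakk>C \<in> P; D \<in> P; C \<noteq> D; x \<in> C; y \<in> D; {x, y} \<in> E\<rbrakk> \<Longrightarrow> {x, y} = {u, v}"
    using crit[OF uv] by metis
  have finS: "finite S" using S finite_V finite_subset by blast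
  have finP: "finite P" using P finite_V by (meson finite_Diff finite_elements)
  have UP: "\<Union>P = V - S" and neP: "{} \<notin> P" and disP: "disjoint P"
    using P by (simp_all add: partition_on_def)
  have dis: "\<And>C D x. \<lbrakk>C \<in> P; D \<in> P; C \<noteq> D; x \<in> C\<rbrakk> \<Longrightarrow> x \<notin> D"
    using disP unfolding pairwise_def disjnt_iff by blast
  have "\<not> separated P"
    using separated_partition(1)[OF P(1) S _ P(2)] small by linarith
  then obtain C D x y where CD: "C \<in> P" "D \<in> P" "C \<noteq> D" "x \<in> C" "y \<in> D" "{x, y} \<in> E"
    unfolding separated_def by blast
  then have "{x, y} = {u, v}" by (rule e)
  then consider "x = u" "y = v" | "x = v" "y = u" by (auto simp: doubleton_eq_iff)
  then obtain C1 C2 where C: "C1 \<in> P" "C2 \<in> P" "C1 \<noteq> C2" "u \<in> C1" "v \<in> C2"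
    using CD by cases metis+
  define Q where "Q = P - {C1, C2}"
  define C where "C = C1 \<union> C2"
  define R where "R = insert C Q"
  have C_notin: "C \<notin> Q"
    using dis[of C C1 u] C unfolding Q_def C_def by blast
  have QP: "Q \<subseteq> P" and finQ: "finite Q" using finP by (auto simp: Q_def)
  have cardP: "card P = card Q + 2"
    using card_Diff_subset[of "{C1, C2}" P] card_mono[of P "{C1, C2}"] finP C
    by (simp add: Q_def)
  have uvQ: "u \<notin> D" "v \<notin> D" if "D \<in> Q" for D
    using dis[of C1 D u] dis[of C2 D v] C that by (auto simp: Q_def)
  have UR: "\<Union>R = V - S" using UP C by (auto simp: R_def Q_def C_def)
  have disR: "disjoint R"
    using dis C unfolding R_def Q_def C_def pairwise_def disjnt_iff by blast
  have sepR: "separated R"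
  proof -
    have no: "{x, y} \<notin> E" if "D \<in> Q" "D' \<in> P" "D \<noteq> D'" "x \<in> D'" "y \<in> D" for D D' x y
    proof
      assume "{x, y} \<in> E"
      then have "{x, y} = {u, v}" using e[of D' D x y] that QP by blast
      then show False using that uvQ by (auto simp: doubleton_eq_iff)
    qed
    have no': "{y, x} \<notin> E" if "D \<in> Q" "D' \<in> P" "D \<noteq> D'" "x \<in> D'" "y \<in> D" for D D' x y
      using no[OF that] by (simp add: insert_commute)
    have "C1 \<notin> Q" "C2 \<notin> Q" by (auto simp: Q_def)
    then show ?thesis
      unfolding separated_def R_def C_def using no no' C QP by blast
  qed
  have NS: "N D \<subseteq> S" if "D \<in> R" for D by (rule N_part_subset[OF sepR UR that])
  have finR: "finite R" using finQ by (simp add: R_def)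
  have sees: "card {D \<in> R. s \<in> N D} \<le> 2" for s
    by (rule card_adjacent_parts_le_2[OF disR sepR])
  define A where "A = {s \<in> S. s \<in> N C1 \<and> s \<in> N C2 \<and> (\<forall>D\<in>Q. s \<notin> N D)}"
  define B where "B = {s \<in> S. s \<in> N C1 \<and> s \<in> N C2 \<and> (\<exists>D\<in>Q. s \<in> N D)}"
  define X1 where "X1 = {s \<in> S. s \<in> N C1 \<and> s \<notin> N C2}"
  define X2 where "X2 = {s \<in> S. s \<notin> N C1 \<and> s \<in> N C2}"
  have subS: "A \<subseteq> S" "B \<subseteq> S" "X1 \<subseteq> S" "X2 \<subseteq> S"
    by (auto simp: A_def B_def X1_def X2_def)
  have fins: "finite A" "finite B" "finite X1" "finite X2"
    using subS finS finite_subset by blast+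
  have NC: "N C = A \<union> B \<union> X1 \<union> X2"
  proof -
    have "N C \<subseteq> S" using NS[of C] by (simp add: R_def)
    moreover have "C1 \<inter> S = {}" "C2 \<inter> S = {}" using C UP by blast+
    ultimately show ?thesis
      unfolding C_def A_def B_def X1_def X2_def by (auto simp: in_N_iff)
  qed
  have cardNC: "card (N C) = card A + card B + card X1 + card X2"
  proof -
    have "card (N C) = card (A \<union> B \<union> X1) + card X2"
      unfolding NC using fins by (intro card_Un_disjoint) (auto simp: A_def B_def X1_def X2_def)
    also have "card (A \<union> B \<union> X1) = card (A \<union> B) + card X1"
      using fins by (intro card_Un_disjoint) (auto simp: A_def B_def X1_def X2_def)
    also have "card (A \<union> B) = card A + card B"
      using fins by (intro card_Un_disjoint) (auto simp: A_def B_def X1_def X2_def)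
    finally show ?thesis .
  qed
  \<comment> \<open>A vertex of \<open>A\<close> sees only the merged part and so misses the maximum
    2 by at least one. This is why \<open>card A\<close> has weight 2 in the bound.\<close>
  have seesA: "card {D \<in> R. s \<in> N D} \<le> 1" if "s \<in> A" for s
  proof -
    have "{D \<in> R. s \<in> N D} \<subseteq> {C}" using that by (auto simp: R_def A_def)
    then show ?thesis using card_mono[of "{C}"] by fastforce
  qed
  have uV: "u \<in> V - S" using C UP by blast
  have NQ: "3 \<le> card (N D)" and NQ_frag: "card (N D) = 3 \<Longrightarrow> fragment D" if "D \<in> Q" for D
  proof -
    have "D \<subseteq> V" "D \<noteq> {}" using that QP UP neP by blast+
    moreover have "u \<in> V - D - N D"
      using uvQ[OF that] uV NS[of D] that by (auto simp: R_def)
    ultimately show "3 \<le> card (N D)" "card (N D) = 3 \<Longrightarrow> fragment D"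
      using conn[of D] by (auto simp: fragment_def)
  qed
  \<comment> \<open>The deficits of the two estimates in the double count: at most two parts are adjacent to each vertex
    of \<open>S\<close>, and at least three vertices to each part.\<close>
  define g where "g = (\<lambda>s. 2 - card {D \<in> R. s \<in> N D})"
  define h where "h = (\<lambda>D. card (N D) - 3)"
  have "(\<Sum>s\<in>S. card {D \<in> R. s \<in> N D}) + sum g S = (\<Sum>s\<in>S. 2)"
    unfolding sum.distrib[symmetric] g_def using sees by (intro sum.cong) auto
  moreover have "(\<Sum>D\<in>R. card (N D)) = card (N C) + (\<Sum>D\<in>Q. card (N D))"
    unfolding R_def using C_notin finQ by simp
  moreover have "(\<Sum>D\<in>Q. card (N D)) = (\<Sum>D\<in>Q. 3) + sum h Q"
    unfolding sum.distrib[symmetric] h_def using NQ by (intro sum.cong) auto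
  moreover have "sum g S = sum g A + sum g (S - A)"
    using subS finS by (metis sum.subset_diff add.commute)
  \<comment> \<open>The constant is \<open>3 * 2 - 1\<close>: two parts were merged into one, and
    \<open>2 * card S < 3 * card P\<close> is strict.\<close>
  ultimately have total: "card (N C) + sum g A + sum g (S - A) + sum h Q \<le> 5"
    using sum_card_N[OF finR finS NS] small cardP by simp
  have gA: "card A \<le> sum g A"
  proof -
    have "(\<Sum>s\<in>A. 1) \<le> sum g A"
      using seesA by (intro sum_mono) (fastforce simp: g_def le_diff_conv2)
    then show ?thesis by simp
  qed
  have le5: "2 * card A + card B + card X1 + card X2 \<le> 5"
    using total gA cardNC by simp
  \<comment> \<open>Equality leaves no deficit outside \<open>A\<close>: the vertex \<open>s\<close>
    sees a second part besides \<open>C\<close>, and that part has exactly three neighbours.\<close>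
  have tight: "\<exists>D. fragment D \<and> s \<in> N D"
    if "2 * card A + card B + card X1 + card X2 = 5" "s \<in> S - A" for s
  proof -
    have "sum g (S - A) = 0" "sum h Q = 0" using that total gA cardNC by linarith+
    then have g0: "g s = 0" and h0: "\<And>D. D \<in> Q \<Longrightarrow> h D = 0"
      using that finS finQ by auto
    have "card {D \<in> R. s \<in> N D} = 2" using g0 sees[of s] by (simp add: g_def)
    then have "\<not> {D \<in> R. s \<in> N D} \<subseteq> {C}" using card_mono[of "{C}" "{D \<in> R. s \<in> N D}"] by auto
    then obtain D where D: "D \<in> Q" "s \<in> N D" by (auto simp: R_def)
    then have "card (N D) = 3" using h0[of D] NQ[of D] by (simp add: h_def)
    then show ?thesis using NQ_frag D by blast
  qed
  have e': "{x, y} = {v, u}" if "C \<in> P" "D \<in> P" "C \<noteq> D" "x \<in> C" "y \<in> D" "{x, y} \<in> E" for C D x y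
    using e[OF that] by (simp add: insert_commute)
  have h1: "N C1 = insert v (N C1 \<inter> S)"
    "N (C1 - {u}) \<subseteq> insert u {s \<in> N C1 \<inter> S. \<not> (s \<in> N C2 \<and> (\<exists>D\<in>Q. s \<in> N D))}"
    using split_half[OF P(1) C uv e] unfolding Q_def by auto
  have h2: "N C2 = insert u (N C2 \<inter> S)"
    "N (C2 - {v}) \<subseteq> insert v {s \<in> N C2 \<inter> S. \<not> (s \<in> N C1 \<and> (\<exists>D\<in>Q. s \<in> N D))}"
    using split_half[OF P(1) C(2,1) C(3)[symmetric] C(5,4) adj_sym[OF uv] e']
    unfolding Q_def by (auto simp: insert_commute)
  have eq: "N C1 \<inter> S = A \<union> B \<union> X1" "N C2 \<inter> S = A \<union> B \<union> X2"
    "{s \<in> N C1 \<inter> S. \<not> (s \<in> N C2 \<and> (\<exists>D\<in>Q. s \<in> N D))} = A \<union> X1"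
    "{s \<in> N C2 \<inter> S. \<not> (s \<in> N C1 \<and> (\<exists>D\<in>Q. s \<in> N D))} = A \<union> X2"
    unfolding A_def B_def X1_def X2_def by auto
  have "N C1 = insert v (A \<union> B \<union> X1)" using h1(1) unfolding eq(1) .
  moreover have "N C2 = insert u (A \<union> B \<union> X2)" using h2(1) unfolding eq(2) .
  moreover have "N (C1 - {u}) \<subseteq> insert u (A \<union> X1)" using h1(2) unfolding eq(3) .
  moreover have "N (C2 - {v}) \<subseteq> insert v (A \<union> X2)" using h2(2) unfolding eq(4) .
  moreover have "\<exists>x\<in>V - S - (C1 \<union> C2). {b, x} \<in> E" if "b \<in> B" for b
  proof -
    obtain D x where D: "D \<in> Q" "x \<in> D" "{x, b} \<in> E"
      using \<open>b \<in> B\<close> by (auto simp: B_def in_N_iff)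
    then have "x \<in> V - S" "x \<notin> C1" "x \<notin> C2"
      using UP dis[of D C1 x] dis[of D C2 x] C(1,2) unfolding Q_def by auto
    then show ?thesis using D by (auto simp: insert_commute)
  qed
  moreover have "C1 \<subseteq> V - S" "C2 \<subseteq> V - S" "C1 \<inter> C2 = {}"
    using UP C(1,2) dis[OF C(1-3)] by blast+
  moreover have "A \<inter> B = {}" "A \<inter> X1 = {}" "A \<inter> X2 = {}" "B \<inter> X1 = {}" "B \<inter> X2 = {}" "X1 \<inter> X2 = {}"
    unfolding A_def B_def X1_def X2_def by auto
  ultimately have "edge_split u v S C1 C2 A B X1 X2"
    unfolding edge_split_def using S subS C(4,5) le5 tight by simp
  then show thesis by (rule that)
qed

section \<open>Splits of an edge at the atom\<close>

lemma card_F': "card F \<le> card F'"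
  using min_frag fragment_compl(1)[OF frag] by (simp add: F'_def)

lemma card_V_gt: "2 * card F + 3 \<le> card V"
proof -
  have "V = (F \<union> N F) \<union> F'" using F_sub N_subset by (auto simp: F'_def)
  moreover have "card ((F \<union> N F) \<union> F') = card (F \<union> N F) + card F'"
    using finite_F finite_V by (intro card_Un_disjoint) (auto simp: F'_def)
  moreover have "card (F \<union> N F) = card F + card (N F)"
    using finite_F N_subset[of F] by (intro card_Un_disjoint) auto
  ultimately show ?thesis using card_F' card_NF by simp
qed

lemma edge_split_parts:
  assumes "edge_split u v S C1 C2 A B X1 X2"
  shows "S \<subseteq> V" "C1 \<subseteq> V - S" "C2 \<subseteq> V - S" "C1 \<inter> C2 = {}" "u \<in> C1" "v \<in> C2"
  using assms unfolding edge_split_def by simp_all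

lemma edge_split_sets:
  assumes "edge_split u v S C1 C2 A B X1 X2"
  shows "A \<subseteq> S" "B \<subseteq> S" "X1 \<subseteq> S" "X2 \<subseteq> S"
    "A \<inter> B = {}" "A \<inter> X1 = {}" "A \<inter> X2 = {}" "B \<inter> X1 = {}" "B \<inter> X2 = {}" "X1 \<inter> X2 = {}"
  using assms unfolding edge_split_def by simp_all

lemma edge_split_N:
  assumes "edge_split u v S C1 C2 A B X1 X2"
  shows "N C1 = insert v (A \<union> B \<union> X1)" "N C2 = insert u (A \<union> B \<union> X2)"
    "N (C1 - {u}) \<subseteq> insert u (A \<union> X1)" "N (C2 - {v}) \<subseteq> insert v (A \<union> X2)"
  using assms unfolding edge_split_def by simp_all

lemma edge_split_le: "edge_split u v S C1 C2 A B X1 X2 \<Longrightarrow> 2 * card A + card B + card X1 + card X2 \<le> 5"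
  unfolding edge_split_def by simp

text \<open>In the equality case \<open>s\<close> belongs to a 3-cut, and no 3-cut meets
  \<open>F\<close>.\<close>

lemma edge_split_tight:
  assumes "edge_split u v S C1 C2 A B X1 X2" "2 * card A + card B + card X1 + card X2 = 5"
    and "s \<in> S - A"
  shows "s \<notin> F"
  using assms fragment_avoids_F unfolding edge_split_def by (metis disjoint_iff)

lemma edge_split_B:
  assumes "edge_split u v S C1 C2 A B X1 X2" "b \<in> B"
  shows "\<exists>x\<in>V - S - (C1 \<union> C2). {b, x} \<in> E"
  using assms unfolding edge_split_def by simp

lemma edge_split_fin:
  assumes "edge_split u v S C1 C2 A B X1 X2"
  shows "finite S" "finite A" "finite B" "finite X1" "finite X2"
proof -
  show "finite S" using edge_split_parts(1)[OF assms] finite_V finite_subset by blast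
  then show "finite A" "finite B" "finite X1" "finite X2"
    using edge_split_sets(1-4)[OF assms] finite_subset by blast+
qed

lemma edge_split_cards:
  assumes s: "edge_split u v S C1 C2 A B X1 X2"
  shows "card (insert x (A \<union> X1)) \<le> Suc (card A + card X1)"
    and "card (insert x (A \<union> B \<union> X1)) \<le> Suc (card A + card B + card X1)"
    and "card (A \<union> B \<union> X1) = card A + card B + card X1"
    and "card (A \<union> B \<union> X1 \<union> X2) = card A + card B + card X1 + card X2"
proof -
  note fin = edge_split_fin[OF s]
  have d: "A \<inter> B = {}" "(A \<union> B) \<inter> X1 = {}" "(A \<union> B \<union> X1) \<inter> X2 = {}"
    using edge_split_sets[OF s] by auto
  show "card (insert x (A \<union> X1)) \<le> Suc (card A + card X1)"
    using card_Un_le[of A X1] card_insert_if[of "A \<union> X1" x] fin by simp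
  show "card (insert x (A \<union> B \<union> X1)) \<le> Suc (card A + card B + card X1)"
    using card_Un_le[of A B] card_Un_le[of "A \<union> B" X1] card_insert_if[of "A \<union> B \<union> X1" x] fin
    by simp
  show *: "card (A \<union> B \<union> X1) = card A + card B + card X1"
    using fin d by (simp add: card_Un_disjoint)
  show "card (A \<union> B \<union> X1 \<union> X2) = card A + card B + card X1 + card X2"
    using fin d * by (simp add: card_Un_disjoint)
qed

text \<open>If \<open>C1\<close> were larger, \<open>insert u (A \<union> X1)\<close> and
  \<open>insert u (A \<union> B \<union> X2)\<close> would both contain separators. As
  \<open>u\<close> lies in no 3-cut, each has at least four elements, so the weighted sum would be
  at least 6 instead of 5.\<close>

lemma split_part_singleton:
  assumes s: "edge_split u v S C1 C2 A B X1 X2" and uF: "u \<in> F"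
  shows "C1 = {u}"
proof (rule ccontr)
  note parts = edge_split_parts[OF s] and sets = edge_split_sets[OF s]
    and NC = edge_split_N[OF s] and le5 = edge_split_le[OF s]
  note fin = edge_split_fin[OF s] and e' = edge_split_sym[OF s]
  assume ne: "C1 \<noteq> {u}"
  have no_frag: "\<not> (fragment X \<and> u \<in> N X)" for X
    using fragment_avoids_F uF by blast
  obtain c where c: "c \<in> C1" "c \<noteq> u" using parts ne by blast
  have v: "v \<in> V" "v \<notin> C1" "v \<notin> S" "v \<noteq> u" using parts by blast+
  have cV: "c \<in> V" "c \<notin> C2" "c \<notin> S" using parts c by blast+
  have sub: "C1 - {u} \<subseteq> V" "C1 - {u} \<noteq> {}" "C2 \<subseteq> V" "C2 \<noteq> {}" using parts c by blast+
  have "\<not> card (insert u (A \<union> X1)) \<le> 3"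
  proof
    assume le: "card (insert u (A \<union> X1)) \<le> 3"
    have "v \<in> V - (C1 - {u})" "v \<notin> insert u (A \<union> X1)" "finite (insert u (A \<union> X1))"
      using v sets fin by blast+
    note N_le_3_imp_fragment[OF sub(1,2) this(1,2) NC(3) this(3) le]
    then show False using no_frag by blast
  qed
  moreover have "card (insert u (A \<union> X1)) \<le> Suc (card A + card X1)"
    by (rule edge_split_cards(1)[OF s])
  ultimately have 1: "card A + card X1 \<ge> 3" by simp
  have "\<not> card (insert u (A \<union> B \<union> X2)) \<le> 3"
  proof
    assume le: "card (insert u (A \<union> B \<union> X2)) \<le> 3"
    have "c \<in> V - C2" "c \<notin> insert u (A \<union> B \<union> X2)" "finite (insert u (A \<union> B \<union> X2))"
      using c cV sets fin by blast+
    note N_le_3_imp_fragment[OF sub(3,4) this(1,2) equalityD1[OF NC(2)] this(3) le]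
    then show False using no_frag by blast
  qed
  moreover have "card (insert u (A \<union> B \<union> X2)) \<le> Suc (card A + card B + card X2)"
    by (rule edge_split_cards(2)[OF e'])
  ultimately have 2: "card A + card B + card X2 \<ge> 3" by simp
  show False using 1 2 le5 by linarith
qed

text \<open>Both parts are shown to be singletons, so \<open>N {u, v}\<close> is the union of
  \<open>A\<close>, \<open>B\<close>, \<open>X1\<close> and \<open>X2\<close>. If it has at most
  three elements it is a 3-cut and avoids \<open>F\<close>; if it has five, \<open>A\<close> is
  empty and equality makes it avoid \<open>F\<close>.\<close>

lemma N_pair_cases:
  assumes uv: "{u, v} \<in> E" and uF: "u \<in> F"
  shows "card (N {u, v}) = 4 \<or> N {u, v} \<inter> F = {}"
proof (rule ccontr)
  assume "\<not> ?thesis"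
  then have n4: "card (N {u, v}) \<noteq> 4" and meets: "N {u, v} \<inter> F \<noteq> {}" by auto
  obtain S C1 C2 A B X1 X2 where s: "edge_split u v S C1 C2 A B X1 X2"
    using ex_edge_split[OF uv] .
  note parts = edge_split_parts[OF s] and sets = edge_split_sets[OF s]
    and NC = edge_split_N[OF s] and le5 = edge_split_le[OF s] and tight = edge_split_tight[OF s]
    and fin = edge_split_fin[OF s]
  note e' = edge_split_sym[OF s]
  have uV: "u \<in> V" "v \<in> V" "u \<noteq> v" using adjD[OF uv] by auto
  have C1: "C1 = {u}" using split_part_singleton[OF s uF] .
  have uC2: "u \<notin> C2" "u \<notin> S" using parts by blast+
  have Nu: "N {u} = insert v (A \<union> B \<union> X1)" using NC(1) C1 by simp
  have "4 \<le> Suc (card A + card B + card X1)"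
    using deg4[of u] uV edge_split_cards(2)[OF s, of v] Nu by simp
  then have deg_u: "3 \<le> card A + card B + card X1" by simp
  \<comment> \<open>The degree of \<open>u\<close> leaves \<open>card A + card X2 \<le> 2\<close>,
    so a larger \<open>C2\<close> makes \<open>insert v (A \<union> X2)\<close> a 3-cut. Then
    equality holds and all of \<open>N {u}\<close> avoids \<open>F\<close>, against the
    connectedness of \<open>F\<close>.\<close>
  have C2: "C2 = {v}"
  proof (rule ccontr)
    assume ne: "C2 \<noteq> {v}"
    have sub: "C2 - {v} \<subseteq> V" "C2 - {v} \<noteq> {}" using parts ne by blast+
    have le: "card (insert v (A \<union> X2)) \<le> 3"
      using edge_split_cards(1)[OF e', of v] deg_u le5 by linarith
    have "u \<in> V - (C2 - {v})" "u \<notin> insert v (A \<union> X2)" "finite (insert v (A \<union> X2))"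
      using uC2 uV sets fin by blast+
    note f = N_le_3_imp_fragment[OF sub this(1,2) NC(4) this(3) le]
    then have vF: "v \<notin> F" "A \<inter> F = {}" using fragment_avoids_F by blast+
    have t: "2 * card A + card B + card X1 + card X2 = 5"
      using edge_split_cards(1)[OF e', of v] f(3) deg_u le5 by linarith
    have "N {u} \<inter> F = {}"
      unfolding Nu using tight[OF t] vF sets by blast
    moreover have "{u} \<noteq> F" using two_le_card_F by auto
    ultimately show False using N_meets_F[of "{u}"] uF by blast
  qed
  have Nv: "N {v} = insert u (A \<union> B \<union> X2)" using NC(2) C2 by simp
  have Nuv: "N {u, v} = A \<union> B \<union> X1 \<union> X2"
  proof -
    have "N {u, v} = (N {u} \<union> N {v}) - {u, v}" by (auto simp: in_N_iff)
    moreover have "u \<notin> A \<union> B \<union> X1 \<union> X2" "v \<notin> A \<union> B \<union> X1 \<union> X2" using parts sets by blast+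
    ultimately show ?thesis unfolding Nu Nv by blast
  qed
  then have c: "card (N {u, v}) = card A + card B + card X1 + card X2"
    using edge_split_cards(4)[OF s] by simp
  have 3: "\<not> card (N {u, v}) \<le> 3"
  proof
    assume le: "card (N {u, v}) \<le> 3"
    have "card ({u, v} \<union> N {u, v}) \<le> card {u, v} + card (N {u, v})" by (rule card_Un_le)
    also have "\<dots> < card V"
      using le card_V_gt two_le_card_F uV by simp
    finally have "\<not> V \<subseteq> {u, v} \<union> N {u, v}"
      using card_mono[of "{u, v} \<union> N {u, v}" V] by auto
    then obtain z where "z \<in> V - {u, v}" "z \<notin> N {u, v}" by blast
    then have "fragment {u, v}"
      using N_le_3_imp_fragment[of "{u, v}" z "N {u, v}"] uV le by auto
    then show False using fragment_avoids_F meets by blast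
  qed
  then have t: "2 * card A + card B + card X1 + card X2 = 5" "card A = 0"
    using c n4 le5 by linarith+
  then have "A = {}" using fin by simp
  then show False using tight[OF t(1)] meets Nuv sets by blast
qed

subsection \<open>Local structure of the atom\<close>

text \<open>By connectedness of \<open>F\<close> the pair has a further neighbour in
  \<open>F\<close>; if \<open>v\<close> lies outside, a neighbour of \<open>u\<close> in
  \<open>F\<close> serves. This excludes the second case of \<open>N_pair_cases\<close>.\<close>

lemma card_N_pair:
  assumes uv: "{u, v} \<in> E" and uF: "u \<in> F" and ne: "{u, v} \<noteq> F"
  shows "card (N {u, v}) = 4"
proof -
  have "N {u, v} \<inter> F \<noteq> {}"
  proof (cases "v \<in> F")
    case True
    then show ?thesis using N_meets_F[of "{u, v}"] uF ne by blast
  next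
    case False
    have "{u} \<noteq> F" using two_le_card_F by auto
    then obtain w where "w \<in> N {u}" "w \<in> F" using N_meets_F[of "{u}"] uF by blast
    moreover have "w \<noteq> v" using False \<open>w \<in> F\<close> by blast
    ultimately have "w \<in> N {u, v} \<inter> F" by (auto simp: in_N_iff)
    then show ?thesis by blast
  qed
  then show ?thesis using N_pair_cases[OF uv uF] by blast
qed

lemma N_F_meets_F': "t \<in> N F \<Longrightarrow> \<exists>x\<in>F'. {t, x} \<in> E"
  using N_F' in_N_iff[of t F'] adj_sym by blast

lemma N_vertex_subset: "u \<in> F \<Longrightarrow> N {u} \<subseteq> F \<union> N F"
  using N_subset_Un[of "{u}" F] by blast

section \<open>Atoms with at least three vertices\<close>

context
  assumes F3: "3 \<le> card F"
begin

lemma card_N_edge: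
  assumes "u \<in> F" "{u, v} \<in> E"
  shows "card (N {u, v}) = 4"
proof -
  have "card {u, v} \<le> 2" by (simp add: card_insert_if)
  then have "{u, v} \<noteq> F" using F3 by auto
  then show ?thesis using card_N_pair assms by blast
qed

text \<open>If the degree of \<open>u\<close> exceeds 4, then for each neighbour \<open>v\<close>
  the four elements of \<open>N {u, v}\<close> are those of \<open>N {u} - {v}\<close>. So the
  closed neighbourhood of \<open>u\<close> has no neighbours at all, although it misses
  \<open>F'\<close>.\<close>

lemma card_N_vertex:
  assumes u: "u \<in> F"
  shows "card (N {u}) = 4"
proof (rule ccontr)
  assume n4: "card (N {u}) \<noteq> 4"
  have uV: "u \<in> V" using u F_sub by blast
  have sub: "N {u} - {v} \<subseteq> N {u, v}" for v by (auto simp: in_N_iff)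
  have eq: "N {u, v} = N {u} - {v}" if v: "{u, v} \<in> E" for v
  proof -
    have "card (N {u} - {v}) = card (N {u}) - 1" using v by simp
    then have "4 \<le> card (N {u} - {v})" using n4 deg4[OF uV] by simp
    then show ?thesis
      using card_seteq[OF _ sub[of v]] card_N_edge[OF u v] by simp
  qed
  define Y where "Y = insert u (N {u})"
  have "N Y = {}"
  proof (rule ccontr)
    assume "N Y \<noteq> {}"
    then obtain y x where y: "y \<notin> Y" "x \<in> Y" "{x, y} \<in> E" using in_N_iff[of _ Y] by blast
    then have ux: "{u, x} \<in> E" by (auto simp: Y_def)
    have "y \<in> N {u, x}" using y by (auto simp: Y_def in_N_iff)
    then show False using eq[OF ux] y by (auto simp: Y_def)
  qed
  moreover have "Y \<subseteq> V" "Y \<noteq> {}" using uV N_subset[of "{u}"] by (auto simp: Y_def)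
  moreover obtain z where "z \<in> F'" using F'_ne by blast
  then have "z \<in> V - Y" using no_edge_F_F'[OF u] u by (auto simp: Y_def F'_def)
  ultimately show False using conn[of Y] by auto
qed

text \<open>Three of the four neighbours of \<open>{u, v}\<close> are the other neighbours of
  \<open>u\<close>, so \<open>v\<close> contributes exactly one more. The neighbours of
  \<open>v\<close> are this one, \<open>u\<close> and the common neighbours.\<close>

lemma card_N_outside:
  assumes u: "u \<in> F" and uv: "{u, v} \<in> E"
  shows "card (N {v} - insert u (N {u})) = 1"
    and "card (N {v}) = card (N {v} \<inter> N {u}) + 2"
proof -
  have "N {u, v} = (N {u} - {v}) \<union> (N {v} - insert u (N {u}))"
    using adjD by (auto simp: in_N_iff)
  then have "4 = card (N {u} - {v}) + card (N {v} - insert u (N {u}))"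
    using card_Un_disjoint[of "N {u} - {v}" "N {v} - insert u (N {u})"] card_N_edge[OF u uv]
    by auto
  moreover have "card (N {u} - {v}) = 3" using card_N_vertex[OF u] uv by simp
  ultimately show 1: "card (N {v} - insert u (N {u})) = 1" by simp
  have "N {v} = insert u (N {v} \<inter> N {u}) \<union> (N {v} - insert u (N {u}))"
    using adj_sym[OF uv] by auto
  then have "card (N {v}) = card (insert u (N {v} \<inter> N {u})) + card (N {v} - insert u (N {u}))"
    using card_Un_disjoint[of "insert u (N {v} \<inter> N {u})" "N {v} - insert u (N {u})"] by auto
  moreover have "u \<notin> N {v} \<inter> N {u}" using adjD[of u u] by auto
  ultimately show "card (N {v}) = card (N {v} \<inter> N {u}) + 2" using 1 by simp
qed

lemma card_common_nbrs:
  assumes "u \<in> F" "{u, v} \<in> E"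
  shows "2 \<le> card (N {v} \<inter> N {u})" "v \<in> F \<Longrightarrow> card (N {v} \<inter> N {u}) = 2"
  using card_N_outside(2)[OF assms] deg4[of v] card_N_vertex[of v] adjD[OF assms(2)] by auto

text \<open>A vertex \<open>t\<close> of the cut has a neighbour in \<open>F'\<close>, which is not
  adjacent to \<open>u\<close>. It must be the only neighbour of \<open>t\<close> outside the closed
  neighbourhood of \<open>u\<close>.\<close>

lemma boundary_nbr:
  assumes u: "u \<in> F" and t: "t \<notin> F" and ut: "{u, t} \<in> E"
  obtains x where "N {t} - insert u (N {u}) = {x}" "x \<in> F'"
proof -
  have "t \<in> N F" using assms in_N_iff by blast
  then obtain x where x: "x \<in> F'" "{t, x} \<in> E" using N_F_meets_F' by blast
  obtain y where y: "N {t} - insert u (N {u}) = {y}"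
    using card_N_outside(1)[OF u ut] by (auto simp: card_1_singleton_iff)
  have "x \<in> N {t} - insert u (N {u})"
    using x no_edge_F_F'[OF u x(1)] u by (auto simp: F'_def)
  then show thesis using that y x(1) by auto
qed

text \<open>The only neighbour of \<open>t\<close> outside the closed neighbourhood of
  \<open>a\<close> lies in \<open>F'\<close>, so it is not adjacent to \<open>u\<close>. This gives
  one inclusion, and equality follows as the right side has two elements and the left at least
  two.\<close>

lemma boundary_triangle:
  assumes u: "u \<in> F" and a: "a \<in> F" and t: "t \<notin> F"
    and ut: "{u, t} \<in> E" and ua: "{u, a} \<in> E" and at: "{a, t} \<in> E"
  shows "N {t} \<inter> N {u} = insert a (N {a} \<inter> N {u}) - {t}"
proof -
  obtain x where x: "N {t} - insert a (N {a}) = {x}" "x \<in> F'"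
    using boundary_nbr[OF a t at] .
  have xu: "x \<notin> N {u}" using x no_edge_F_F'[OF u] by auto
  have sub: "N {t} \<inter> N {u} \<subseteq> insert a (N {a} \<inter> N {u}) - {t}"
  proof -
    have "t \<notin> N {t}" using adjD[of t t] by auto
    then show ?thesis using equalityD1[OF x(1)] xu by blast
  qed
  have "card (N {a} \<inter> N {u}) = 2" using card_common_nbrs(2)[OF u ua a] .
  moreover have "a \<notin> N {a} \<inter> N {u}" using adjD[of a a] by auto
  ultimately have "card (insert a (N {a} \<inter> N {u})) = 3" by simp
  moreover have "t \<in> insert a (N {a} \<inter> N {u})" using ut at by auto
  ultimately have "card (insert a (N {a} \<inter> N {u}) - {t}) = 2" by simp
  then show ?thesis
    using card_seteq[OF _ sub] card_common_nbrs(1)[OF u ut] by simp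
qed

text \<open>Let \<open>c\<close> be the other common neighbour of \<open>u\<close> and
  \<open>a\<close>. Inside \<open>N {u}\<close>, each of \<open>a\<close>, \<open>t\<close>,
  \<open>c\<close> is adjacent to exactly the other two, so the fourth neighbour of \<open>u\<close>
  has no common neighbour with \<open>u\<close>, where two are required.\<close>

lemma no_boundary_triangle:
  assumes u: "u \<in> F" and a: "a \<in> F" and t: "t \<notin> F"
    and ut: "{u, t} \<in> E" and ua: "{u, a} \<in> E" and at: "{a, t} \<in> E"
  shows False
proof -
  have K2: "card (N {a} \<inter> N {u}) = 2" using card_common_nbrs(2)[OF u ua a] .
  have tK: "t \<in> N {a} \<inter> N {u}" using ut at by auto
  then have "card (N {a} \<inter> N {u} - {t}) = 1" using K2 by simp
  then obtain c where c: "N {a} \<inter> N {u} - {t} = {c}" by (auto simp: card_1_singleton_iff)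
  have K: "N {a} \<inter> N {u} = {t, c}" using insert_Diff[OF tK] unfolding c by simp
  have ct: "c \<noteq> t" using equalityD2[OF c] by blast
  have ac: "{a, c} \<in> E" and uc: "{u, c} \<in> E" using K by (auto simp: set_eq_iff)
  have ca: "c \<noteq> a" "a \<noteq> t" using adjD[OF ac] adjD[OF at] by auto
  have L: "N {t} \<inter> N {u} = {a, c}"
    unfolding boundary_triangle[OF assms] K using ct ca by auto
  have tc: "{t, c} \<in> E" using L by (auto simp: set_eq_iff)
  \<comment> \<open>Inside \<open>F\<close> counting suffices; outside, \<open>c\<close> is itself a
    boundary vertex adjacent to \<open>u\<close> and \<open>a\<close> and takes the place of
    \<open>t\<close>.\<close>
  have M: "N {c} \<inter> N {u} = {a, t}"
  proof (cases "c \<in> F")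
    case True
    then have "card (N {c} \<inter> N {u}) = 2" using card_common_nbrs(2)[OF u uc] by simp
    moreover have "{a, t} \<subseteq> N {c} \<inter> N {u}"
      using adj_sym[OF ac] adj_sym[OF tc] ut ua by simp
    moreover have "card {a, t} = 2" using ca by simp
    ultimately show ?thesis using card_seteq[of "N {c} \<inter> N {u}" "{a, t}"] by simp
  next
    case False
    then show ?thesis
      unfolding boundary_triangle[OF u a False uc ua ac] K using ct ca by auto
  qed
  have "card (N {u}) = 4" "card {a, t, c} \<le> 3"
    using card_N_vertex[OF u] by (auto simp: card_insert_if)
  then have "\<not> N {u} \<subseteq> {a, t, c}" using card_mono[of "{a, t, c}" "N {u}"] by auto
  then obtain d where d: "d \<in> N {u}" "d \<notin> {a, t, c}" by blast
  have nd: "{a, d} \<notin> E" "{t, d} \<notin> E" "{c, d} \<notin> E"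
    using K L M d by (auto simp: set_eq_iff)
  have "N {d} \<inter> N {u} \<subseteq> N {u} - {a, t, c, d}"
    using nd adj_sym[of d] adjD[of d d] by auto
  then have "card (N {d} \<inter> N {u}) \<le> card (N {u} - {a, t, c, d})"
    by (intro card_mono) auto
  moreover have "{a, t, c, d} \<subseteq> N {u}" using ua ut uc d by auto
  then have "card (N {u} - {a, t, c, d}) = 0"
    using d ct ca card_N_vertex[OF u] card_Diff_subset[of "{a, t, c, d}" "N {u}"] by auto
  ultimately show False using card_common_nbrs(1)[OF u, of d] d by simp
qed

text \<open>Suppose \<open>u\<close> in \<open>F\<close> has a neighbour \<open>t\<close> outside.
  Having degree 4, it also has a neighbour \<open>a\<close> in \<open>F\<close>; without boundary
  triangles, \<open>a\<close> and its two common neighbours with \<open>u\<close> lie in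
  \<open>F\<close>, so \<open>t\<close> is the only neighbour outside. A common neighbour of
  \<open>t\<close> and \<open>u\<close> then completes a boundary triangle.\<close>

lemma card_F_ge_3_False: False
proof -
  have "N {u} \<subseteq> F" if u: "u \<in> F" for u
  proof (rule ccontr)
    assume "\<not> N {u} \<subseteq> F"
    then obtain t where "t \<in> N {u}" "t \<notin> F" by blast
    then have t: "{u, t} \<in> E" "t \<notin> F" by simp_all
    have "\<not> N {u} \<subseteq> N F"
      using card_mono[of "N F" "N {u}"] card_N_vertex[OF u] card_NF by auto
    then obtain a where "a \<in> N {u}" "a \<notin> N F" by blast
    then have a: "{u, a} \<in> E" "a \<in> F" using N_vertex_subset[OF u] by auto
    have K: "card (N {a} \<inter> N {u}) = 2" using card_common_nbrs(2)[OF u a] .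
    have "N {a} \<inter> N {u} \<subseteq> F"
      using no_boundary_triangle[OF u a(2) _ _ a(1)] by (intro subsetI, rule ccontr) auto
    then have KF: "insert a (N {a} \<inter> N {u}) \<subseteq> N {u} \<inter> F" using a by auto
    have "a \<notin> N {a} \<inter> N {u}" using adjD[of a a] by auto
    then have "3 \<le> card (N {u} \<inter> F)"
      using card_mono[OF _ KF] K by simp
    moreover have "card (N {u}) = card (N {u} \<inter> F) + card (N {u} - F)"
      by (rule card_Int_Diff) simp
    ultimately have "card (N {u} - F) \<le> 1" using card_N_vertex[OF u] by simp
    then have only: "s = t" if "s \<in> N {u} - F" for s
      using that t card_le_Suc0_iff_eq[of "N {u} - F"] by auto
    have "N {t} \<inter> N {u} \<noteq> {}" using card_common_nbrs(1)[OF u t(1)] by auto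
    then obtain b where b: "{t, b} \<in> E" "{u, b} \<in> E" by auto
    then have "b \<noteq> t" using adjD by blast
    then have "b \<in> F" using only[of b] b by auto
    then show False using no_boundary_triangle[OF u _ t(2,1) b(2) adj_sym[OF b(1)]] by blast
  qed
  then have "N F = {}" unfolding in_N_iff set_eq_iff
    by (metis in_N_singleton subsetD empty_iff)
  then show False using card_NF by simp
qed

end

section \<open>Atoms with two vertices\<close>

text \<open>If \<open>w\<close> were in \<open>C1\<close>, then \<open>C1 - {x}\<close> would have
  the neighbour \<open>y\<close>, contrary to the split. So \<open>w\<close> is a neighbour of
  \<open>C1\<close>, and by symmetry of \<open>C2\<close>.\<close>

lemma common_nbr_in_split:
  assumes s: "edge_split x y S C1 C2 A B X1 X2" and w: "{w, x} \<in> E" "{w, y} \<in> E"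
  shows "w \<in> A \<union> B"
proof -
  have half: "w \<in> A' \<union> B' \<union> X1'" if s: "edge_split x' y' S' C1' C2' A' B' X1' X2'"
    and w: "{w, x'} \<in> E" "{w, y'} \<in> E" for x' y' S' C1' C2' A' B' X1' X2'
  proof -
    note parts = edge_split_parts[OF s] and sets = edge_split_sets[OF s] and NC = edge_split_N[OF s]
    have y: "y' \<notin> C1'" "y' \<notin> S'" using parts by blast+
    have "w \<notin> C1'"
    proof
      assume "w \<in> C1'"
      then have "y' \<in> N (C1' - {x'})" using w y adjD[OF w(1)] by (auto simp: in_N_iff)
      then have "y' \<in> insert x' (A' \<union> X1')" using NC(3) by blast
      then show False using y sets parts(5) by blast
    qed
    then have "w \<in> N C1'" using adj_sym[OF w(1)] parts(5) in_N_iff by blast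
    then show ?thesis using NC(1) adjD[OF w(2)] by simp
  qed
  have "w \<in> A \<union> B \<union> X1" using half[OF s w] .
  moreover have "w \<in> A \<union> B \<union> X2" using half[OF edge_split_sym[OF s] w(2,1)] .
  ultimately show ?thesis using edge_split_sets(10)[OF s] by blast
qed

text \<open>Variant of \<open>split_part_singleton\<close> for edges outside \<open>F\<close>:
  instead of an end of the edge, two common neighbours in \<open>F\<close> are kept off the 3-cuts.
  If \<open>C1\<close> were larger, \<open>insert x (A \<union> X1)\<close> would be a 3-cut, so
  \<open>u\<close> and \<open>v\<close> would lie in \<open>B\<close>; then \<open>C2 = {y}\<close>,
  and equality is reached, which forbids \<open>u\<close> in \<open>B\<close>.\<close>

lemma split_part_singleton_common:
  assumes s: "edge_split x y S C1 C2 A B X1 X2" and uv: "u \<in> F" "v \<in> F" "u \<noteq> v"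
    and AB: "u \<in> A \<union> B" "v \<in> A \<union> B"
  shows "C1 = {x}"
proof (rule ccontr)
  assume ne: "C1 \<noteq> {x}"
  note parts = edge_split_parts[OF s] and sets = edge_split_sets[OF s]
    and NC = edge_split_N[OF s] and le5 = edge_split_le[OF s] and fin = edge_split_fin[OF s]
  note e' = edge_split_sym[OF s]
  obtain c where c: "c \<in> C1" "c \<noteq> x" using parts ne by blast
  have xV: "x \<in> V" "x \<notin> S" "x \<notin> C2" using parts by blast+
  have yV: "y \<in> V" "y \<notin> S" "y \<notin> C1" "y \<noteq> x" using parts by blast+
  have cV: "c \<in> V" "c \<notin> S" "c \<notin> C2" using parts c by blast+
  have sub: "C1 - {x} \<subseteq> V" "C1 - {x} \<noteq> {}" "C2 \<subseteq> V" "C2 \<noteq> {}" using parts c by blast+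
  have y_out: "y \<in> V - (C1 - {x})" "y \<notin> insert x (A \<union> X1)" "finite (insert x (A \<union> X1))"
    using yV sets fin by blast+
  have "3 \<le> card (insert x (A \<union> X1))"
    by (rule N_ge_3[OF sub(1,2) y_out(1,2) NC(3) y_out(3)])
  then have AX1: "2 \<le> card A + card X1" using edge_split_cards(1)[OF s, of x] by simp
  have "\<not> card A + card B + card X2 \<le> 2"
  proof
    assume "card A + card B + card X2 \<le> 2"
    then have le: "card (insert x (A \<union> B \<union> X2)) \<le> 3"
      using edge_split_cards(2)[OF e', of x] by simp
    have "c \<in> V - C2" "c \<notin> insert x (A \<union> B \<union> X2)" "finite (insert x (A \<union> B \<union> X2))"
      using c cV sets fin by blast+
    note f = N_le_3_imp_fragment[OF sub(3,4) this(1,2) equalityD1[OF NC(2)] this(3) le]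
    then have "u \<in> N C2" using AB by blast
    then show False using fragment_avoids_F[OF f(1)] uv by blast
  qed
  then have AX1': "card A + card X1 = 2" using AX1 le5 by linarith
  then have le: "card (insert x (A \<union> X1)) \<le> 3" using edge_split_cards(1)[OF s, of x] by simp
  note f = N_le_3_imp_fragment[OF sub(1,2) y_out(1,2) NC(3) y_out(3) le]
  have "A \<inter> F = {}" using fragment_avoids_F[OF f(1)] f(2) by blast
  then have B: "u \<in> B" "v \<in> B" using AB uv by blast+
  have "card {u, v} \<le> card B" using B fin by (intro card_mono) auto
  then have B2: "2 \<le> card B" using uv by simp
  have C2: "C2 = {y}"
  proof (rule ccontr)
    assume "C2 \<noteq> {y}"
    then have sub2: "C2 - {y} \<subseteq> V" "C2 - {y} \<noteq> {}" using parts by blast+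
    have "x \<in> V - (C2 - {y})" "x \<notin> insert y (A \<union> X2)" "finite (insert y (A \<union> X2))"
      using xV yV sets fin by blast+
    then have "3 \<le> card (insert y (A \<union> X2))"
      by (rule N_ge_3[OF sub2 _ _ NC(4)])
    then show False using edge_split_cards(1)[OF e', of y] AX1' B2 le5 by linarith
  qed
  then have "4 \<le> Suc (card A + card B + card X2)"
    using deg4[OF yV(1)] edge_split_cards(2)[OF e', of x] NC(2) by simp
  then have "2 * card A + card B + card X1 + card X2 = 5" using AX1' le5 by linarith
  from edge_split_tight[OF s this, of u] show False using B uv sets by blast
qed

text \<open>If \<open>F = {u, v}\<close>, then \<open>F \<union> N F\<close> may well induce a \<open>K\<^sub>5\<close>, all of whose edges at \<open>F\<close> can be critical; the
  contradiction has to come from an edge inside \<open>N F\<close>.\<close>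

lemma card_F_2_False:
  assumes F2: "card F = 2"
  shows False
proof -
  obtain u v where F: "F = {u, v}" and uv: "u \<noteq> v" using F2 by (auto simp: card_2_iff)
  \<comment> \<open>Only the other vertex of \<open>F\<close> and the three vertices of
    \<open>N F\<close> can be adjacent to \<open>p\<close>, and the degree is at least 4.\<close>
  have N_F_vertex: "N {p} = insert q (N F)" if "F = {p, q}" for p q
  proof -
    have "N {p} \<subseteq> F \<union> N F" using N_vertex_subset[of p] that by blast
    moreover have "p \<notin> N {p}" using adjD[of p p] by auto
    ultimately have sub: "N {p} \<subseteq> insert q (N F)" using that by blast
    have "card (insert q (N F)) \<le> 4" using card_NF by (simp add: card_insert_if)
    then show ?thesis using card_seteq[OF _ sub] deg4[of p] F_sub that by simp
  qed
  have Nu: "N {u} = insert v (N F)" using N_F_vertex F by blast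
  have Nv: "N {v} = insert u (N F)" using N_F_vertex[of v u] F by (simp add: insert_commute)
  have adj: "{u, t} \<in> E" "{v, t} \<in> E" if "t \<in> N F" for t
    using Nu Nv that by (auto simp: set_eq_iff)
  have uvF: "u \<in> F" "v \<in> F" "u \<notin> N F" "v \<notin> N F" using F by (auto simp: in_N_iff)
  \<comment> \<open>The four neighbours of \<open>{u, t}\<close> are \<open>v\<close>, two in
    \<open>N F\<close> and one in \<open>F'\<close>. With two neighbours in \<open>F\<close> and one
    in \<open>F'\<close>, degree 4 requires \<open>t\<close> to have one in
    \<open>N F\<close>.\<close>
  have nbr_T: "\<exists>s\<in>N F. {t, s} \<in> E" if t: "t \<in> N F" for t
  proof -
    have tV: "t \<in> V" "t \<notin> F" using t N_subset by blast+
    have VF: "V = F \<union> N F \<union> F'" using F_sub N_subset by (auto simp: F'_def)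
    have "N {u, t} = insert v (N F - {t}) \<union> (N {t} \<inter> F')"
    proof (intro equalityI subsetI)
      fix y assume y: "y \<in> N {u, t}"
      then have "y \<in> V" "y \<noteq> u" "y \<noteq> t" using N_subset by blast+
      moreover have "y \<in> N {t}" if "y \<in> F'"
        using y no_edge_F_F'[OF uvF(1) that] by (auto simp: in_N_iff)
      ultimately show "y \<in> insert v (N F - {t}) \<union> (N {t} \<inter> F')" using VF F by blast
    next
      fix y assume "y \<in> insert v (N F - {t}) \<union> (N {t} \<inter> F')"
      moreover have "{u, v} \<in> E" using Nu by (auto simp: set_eq_iff)
      moreover have "v \<noteq> t" using uvF t by blast
      ultimately show "y \<in> N {u, t}"
        using adj(1) uv uvF adjD[of t y] by (auto simp: in_N_iff F'_def)
    qed
    moreover have "card (N {u, t}) = 4"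
      using card_N_pair[OF adj(1)[OF t] uvF(1)] tV by blast
    moreover have "insert v (N F - {t}) \<inter> (N {t} \<inter> F') = {}" using uvF by (auto simp: F'_def)
    ultimately have "card (insert v (N F - {t})) + card (N {t} \<inter> F') = 4"
      by (metis card_Un_disjoint finite_Diff finite_Int finite_N finite_insert)
    moreover have "card (insert v (N F - {t})) = 3" using uvF card_NF t by simp
    ultimately have c1: "card (N {t} \<inter> F') = 1" by simp
    have "N {t} \<subseteq> F \<union> (N {t} \<inter> N F) \<union> (N {t} \<inter> F')"
      using N_subset[of "{t}"] VF by blast
    then have "card (N {t}) \<le> card (F \<union> (N {t} \<inter> N F) \<union> (N {t} \<inter> F'))"
      using finite_F by (intro card_mono) auto
    also have "\<dots> \<le> card F + card (N {t} \<inter> N F) + card (N {t} \<inter> F')"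
      using card_Un_le[of "F \<union> (N {t} \<inter> N F)" "N {t} \<inter> F'"] card_Un_le[of F "N {t} \<inter> N F"] by simp
    finally have "1 \<le> card (N {t} \<inter> N F)" using c1 F2 deg4[OF tV(1)] by linarith
    then have "N {t} \<inter> N F \<noteq> {}" by force
    then show ?thesis by auto
  qed
  obtain t1 where t1: "t1 \<in> N F" using card_NF by (metis card.empty ex_in_conv zero_neq_numeral)
  then obtain t2 where t2: "t2 \<in> N F" "{t1, t2} \<in> E" using nbr_T by blast
  have t12: "t1 \<noteq> t2" using adjD t2 by blast
  have "card (N F - {t1, t2}) = 1" using t1 t2 t12 card_NF by (simp add: card_Diff_subset)
  then obtain t3 where "N F - {t1, t2} = {t3}" by (auto simp: card_1_singleton_iff)
  then have T: "N F = {t1, t2, t3}" "t3 \<noteq> t1" "t3 \<noteq> t2" using t1 t2 by auto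
  then obtain s3 where "s3 \<in> N F" "{t3, s3} \<in> E" using nbr_T[of t3] by blast
  then have t3: "{t1, t3} \<in> E \<or> {t2, t3} \<in> E" using T adjD[of t3 t3] adj_sym by auto
  obtain S C1 C2 A B X1 X2 where s: "edge_split t1 t2 S C1 C2 A B X1 X2"
    using ex_edge_split[OF t2(2)] .
  note sets = edge_split_sets[OF s]
    and NC = edge_split_N[OF s] and le5 = edge_split_le[OF s] and fin = edge_split_fin[OF s]
  have AB: "u \<in> A \<union> B" "v \<in> A \<union> B"
    using common_nbr_in_split[OF s] adj t1 t2 by blast+
  have C1: "C1 = {t1}" using split_part_singleton_common[OF s uvF(1,2) uv AB] .
  have C2: "C2 = {t2}"
    using split_part_singleton_common[OF edge_split_sym[OF s] uvF(1,2) uv AB] .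
  have "t3 \<in> N C1 \<or> t3 \<in> N C2" using t3 C1 C2 by simp
  then have t3S: "t3 \<in> A \<union> B \<union> X1 \<union> X2" using NC(1,2) T by blast
  have uvS: "u \<in> S" "v \<in> S" "t3 \<in> S" using AB t3S sets by blast+
  \<comment> \<open>A vertex of \<open>B\<close> has a neighbour in a third part, but every
    neighbour of \<open>F\<close> lies in \<open>S\<close>, \<open>C1\<close> or
    \<open>C2\<close>.\<close>
  have inA: "p \<in> A" if p: "p \<in> F" for p
  proof (rule ccontr)
    assume "p \<notin> A"
    then have "p \<in> B" using p AB F by blast
    then obtain x where x: "x \<in> V - S - (C1 \<union> C2)" "{p, x} \<in> E" using edge_split_B[OF s] by blast
    have "x \<in> N {u} \<union> N {v}" using x(2) p unfolding F by auto
    then have "x \<in> {u, v, t1, t2, t3}" unfolding Nu Nv T(1) by blast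
    then show False using x uvS C1 C2 by blast
  qed
  obtain x where x: "x \<in> F'" "{t1, x} \<in> E" using N_F_meets_F'[OF t1] by blast
  have "x \<in> N C1" "x \<noteq> t2" "x \<noteq> t3" using x C1 t2 T(1) by (auto simp: F'_def)
  then have xS: "x \<in> A \<union> B \<union> X1 \<union> X2" using NC(1) by blast
  have "card {u, v} \<le> card A" using inA uvF fin by (intro card_mono) auto
  then have A2: "2 \<le> card A" using uv by simp
  \<comment> \<open>Four distinct vertices, of which \<open>u\<close> and \<open>v\<close> count
    twice, give 6 where the split allows 5.\<close>
  have "{u, v, t3, x} \<subseteq> A \<union> B \<union> X1 \<union> X2" using AB t3S xS by blast
  then have "card {u, v, t3, x} \<le> card A + card B + card X1 + card X2"
    using edge_split_cards(4)[OF s] fin card_mono[of "A \<union> B \<union> X1 \<union> X2" "{u, v, t3, x}"] by simp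
  moreover have "card {u, v, t3, x} = 4"
  proof -
    have "x \<notin> F" "x \<notin> N F" "t3 \<notin> F" "t3 \<in> N F" using x T N_subset[of F] by (auto simp: F'_def)
    then have "x \<noteq> u" "x \<noteq> v" "x \<noteq> t3" "t3 \<noteq> u" "t3 \<noteq> v" using F by blast+
    then show ?thesis using uv by auto
  qed
  ultimately show False using A2 le5 by linarith
qed

lemma contradiction: False
  using card_F_2_False card_F_ge_3_False two_le_card_F by fastforce

end

subsection \<open>Components and toughness\<close>

lemma equiv_connected_rel: "equiv (gverts H) (connected_rel H)"
proof (rule equivI)
  have "sym {(x, y). {x, y} \<in> gedges H}" by (auto simp: sym_def insert_commute)
  then have "sym ({(x, y). {x, y} \<in> gedges H}\<^sup>*)" by (rule sym_rtrancl)
  then show "sym (connected_rel H)" unfolding connected_rel_def sym_def by blast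
  show "trans (connected_rel H)"
    unfolding connected_rel_def trans_def by (auto intro: rtrancl_trans)
  show "refl_on (gverts H) (connected_rel H)" "connected_rel H \<subseteq> gverts H \<times> gverts H"
    unfolding connected_rel_def refl_on_def by auto
qed

lemma partition_graph_components: "partition_on (gverts H) (graph_components H)"
  unfolding graph_components_def by (rule partition_on_quotient[OF equiv_connected_rel])

lemma adjacent_same_component:
  assumes "C \<in> graph_components H" "D \<in> graph_components H" "x \<in> C" "y \<in> D"
    and xy: "{x, y} \<in> gedges H"
  shows "C = D"
proof -
  have "x \<in> gverts H" "y \<in> gverts H"
    using assms partition_onD1[OF partition_graph_components[of H]] by blast+
  then have "(x, y) \<in> connected_rel H" using xy by (auto simp: connected_rel_def)
  then show ?thesis
    using quotient_eq_iff[OF equiv_connected_rel assms(1,2)[unfolded graph_components_def] assms(3,4)]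
    by simp
qed

text \<open>A path starting at \<open>x\<close> cannot leave the closed set \<open>X\<close>, so
  \<open>y\<close> lies in another component.\<close>

lemma two_components:
  assumes fin: "finite (gverts H)" and x: "x \<in> X" "x \<in> gverts H" and y: "y \<in> gverts H" "y \<notin> X"
    and closed: "\<And>a b. a \<in> X \<Longrightarrow> {a, b} \<in> gedges H \<Longrightarrow> b \<in> X"
  shows "2 \<le> num_components H"
proof (rule ccontr)
  let ?P = "graph_components H"
  have finP: "finite ?P" using finite_elements[OF fin partition_graph_components] .
  assume "\<not> ?thesis"
  then have le: "card ?P \<le> Suc 0" by (simp add: num_components_def)
  have xC: "connected_rel H `` {x} \<in> ?P" "connected_rel H `` {y} \<in> ?P"
    unfolding graph_components_def using x y by (auto intro: quotientI)
  then have "connected_rel H `` {x} = connected_rel H `` {y}"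
    using le card_le_Suc0_iff_eq[OF finP] by blast
  then have "(x, y) \<in> connected_rel H"
    using eq_equiv_class[OF _ equiv_connected_rel y(1)] by metis
  then have "(x, y) \<in> {(x, y). {x, y} \<in> gedges H}\<^sup>*" by (auto simp: connected_rel_def)
  then have "y \<in> X" by (induction rule: rtrancl_induct) (use x closed in auto)
  then show False using y by simp
qed

section \<open>Toughness as an attained minimum, and the passage to the locales\<close>

definition toughness_ratios :: "'a ugraph \<Rightarrow> ereal set" where
  "toughness_ratios G = {ereal (real (card S) / real (num_components (delete_verts G S))) | S.
     S \<subseteq> gverts G \<and> num_components (delete_verts G S) \<ge> 2}"

lemma toughness_noncomplete: "\<not> complete_graph G \<Longrightarrow> toughness G = Min (toughness_ratios G)"
  by (simp add: toughness_def toughness_ratios_def)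

lemma finite_toughness_ratios:
  assumes "simple_graph G"
  shows "finite (toughness_ratios G)"
proof -
  have "toughness_ratios G \<subseteq>
    (\<lambda>S. ereal (real (card S) / real (num_components (delete_verts G S)))) ` Pow (gverts G)"
    by (auto simp: toughness_ratios_def)
  then show ?thesis using assms finite_subset by (auto simp: simple_graph_def)
qed

lemma gverts_delete_verts [simp]: "gverts (delete_verts G S) = gverts G - S"
  by (simp add: delete_verts_def induced_subgraph_def)

lemma gedges_delete_verts: "gedges (delete_verts G S) = {e \<in> gedges G. e \<subseteq> gverts G - S}"
  by (simp add: delete_verts_def induced_subgraph_def)

lemma toughness_ratios_nonempty:
  assumes G: "simple_graph G" and nc: "\<not> complete_graph G"
  shows "toughness_ratios G \<noteq> {}"
proof -
  obtain u v where uv: "u \<in> gverts G" "v \<in> gverts G" "u \<noteq> v" "{u, v} \<notin> gedges G"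
    using nc by (auto simp: complete_graph_def)
  let ?H = "delete_verts G (gverts G - {u, v})"
  have "2 \<le> num_components ?H"
  proof (rule two_components[where x = u and X = "{u}" and y = v])
    show "finite (gverts ?H)" using G by (simp add: simple_graph_def)
    show "b \<in> {u}" if "a \<in> {u}" "{a, b} \<in> gedges ?H" for a b
    proof -
      have "b \<in> {u, v}" "{u, b} \<in> gedges G" using that uv by (auto simp: gedges_delete_verts)
      then show ?thesis using uv by auto
    qed
  qed (use uv in auto)
  then show ?thesis unfolding toughness_ratios_def by blast
qed

lemma toughness_attained:
  assumes "simple_graph G" "\<not> complete_graph G"
  obtains S where "S \<subseteq> gverts G" "2 \<le> num_components (delete_verts G S)"
    "toughness G = ereal (real (card S) / real (num_components (delete_verts G S)))"
proof -
  have "toughness G \<in> toughness_ratios G"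
    using Min_in[OF finite_toughness_ratios toughness_ratios_nonempty] assms
    by (simp add: toughness_noncomplete)
  then show thesis using that unfolding toughness_ratios_def by blast
qed

lemma toughness_le:
  assumes "simple_graph G" "\<not> complete_graph G" "S \<subseteq> gverts G"
    and "2 \<le> num_components (delete_verts G S)"
  shows "toughness G \<le> ereal (real (card S) / real (num_components (delete_verts G S)))"
  unfolding toughness_noncomplete[OF assms(2)]
  using assms by (intro Min_le finite_toughness_ratios) (auto simp: toughness_ratios_def)

text \<open>Otherwise \<open>a\<close> as the centre and \<open>b\<close>, \<open>c\<close>,
  \<open>d\<close> as leaves induce a claw; the map \<open>f\<close> is the explicit
  isomorphism.\<close>

lemma claw_free_adjacent:
  assumes G: "simple_graph G" and cf: "claw_free G"
    and adj: "{a, b} \<in> gedges G" "{a, c} \<in> gedges G" "{a, d} \<in> gedges G"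
    and ne: "b \<noteq> c" "b \<noteq> d" "c \<noteq> d"
  shows "{b, c} \<in> gedges G \<or> {b, d} \<in> gedges G \<or> {c, d} \<in> gedges G"
proof (rule ccontr)
  assume "\<not> ?thesis"
  then have no: "{b, c} \<notin> gedges G" "{b, d} \<notin> gedges G" "{c, d} \<notin> gedges G" by auto
  have edge: "e \<subseteq> gverts G" "card e = 2" if "e \<in> gedges G" for e
    using G that by (auto simp: simple_graph_def)
  have loop: "{x} \<notin> gedges G" for x using edge(2)[of "{x}"] by auto
  have ane: "a \<noteq> b" "a \<noteq> c" "a \<noteq> d" using adj loop by auto
  let ?U = "{a, b, c, d}"
  have U: "?U \<subseteq> gverts G" using edge(1)[OF adj(1)] edge(1)[OF adj(2)] edge(1)[OF adj(3)] by auto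
  define f :: "'a \<Rightarrow> nat + nat" where
    "f = (\<lambda>x. if x = a then Inl 0 else if x = b then Inr 0 else if x = c then Inr 1 else Inr 2)"
  have f: "f a = Inl 0" "f b = Inr 0" "f c = Inr 1" "f d = Inr 2"
    using ne ane by (auto simp: f_def)
  have K: "gverts (complete_bipartite 1 3) = {Inl 0, Inr 0, Inr 1, Inr 2}"
    by (auto simp: complete_bipartite_def lessThan_Suc numeral_3_eq_3 numeral_2_eq_2)
  have KE: "{p, q} \<in> gedges (complete_bipartite 1 3) \<longleftrightarrow>
      (\<exists>j<3. p = Inl 0 \<and> q = Inr j \<or> p = Inr j \<and> q = Inl 0)" for p q
    by (auto simp: complete_bipartite_def doubleton_eq_iff)
  have "bij_betw f ?U (gverts (complete_bipartite 1 3))"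
    unfolding bij_betw_def K using f ne ane by (auto simp: inj_on_def)
  moreover have "{x, y} \<in> gedges (induced_subgraph G ?U) \<longleftrightarrow>
      {f x, f y} \<in> gedges (complete_bipartite 1 3)" if "x \<in> ?U" "y \<in> ?U" for x y
  proof -
    have "{x, y} \<in> gedges (induced_subgraph G ?U) \<longleftrightarrow> {x, y} \<in> gedges G"
      using that by (auto simp: induced_subgraph_def)
    moreover have "{x, y} \<in> gedges G \<longleftrightarrow> {f x, f y} \<in> gedges (complete_bipartite 1 3)"
      unfolding KE using that adj no f loop
      by (elim insertE emptyE) (simp_all add: insert_commute)
    ultimately show ?thesis by simp
  qed
  ultimately have "graph_isomorphic (induced_subgraph G ?U) (complete_bipartite 1 3)"
    unfolding graph_isomorphic_def by (auto simp: induced_subgraph_def)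
  then show False using cf U unfolding claw_free_def by blast
qed

text \<open>Links \<open>vertex_degree\<close> to neighbourhoods: edges at \<open>v\<close>
  correspond to their other ends.\<close>

lemma (in claw_free_graph) card_incident_edges: "card {e \<in> E. v \<in> e} = card (N {v})"
proof -
  have "{e \<in> E. v \<in> e} = (\<lambda>y. {v, y}) ` N {v}"
  proof (intro equalityI subsetI)
    fix e assume e: "e \<in> {e \<in> E. v \<in> e}"
    then obtain y where "e = {v, y}" using edges[of e] by (auto simp: card_2_iff)
    then show "e \<in> (\<lambda>y. {v, y}) ` N {v}" using e by auto
  qed auto
  moreover have "inj_on (\<lambda>y. {v, y}) (N {v})" by (auto simp: inj_on_def doubleton_eq_iff)
  ultimately show ?thesis by (simp add: card_image)
qed

theorem theorem1p7:
  fixes G :: "'a ugraph"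
  assumes "simple_graph G"
    and "minimally_tough (3 / 2) G"
    and "claw_free G"
  shows "\<exists>v\<in>gverts G. vertex_degree G v = 3"
proof (rule ccontr)
  assume no3: "\<not> ?thesis"
  have tough: "toughness G = ereal (3 / 2)"
    and crit: "\<And>e. e \<in> gedges G \<Longrightarrow> toughness (delete_edge G e) < ereal (3 / 2)"
    using assms(2) by (auto simp: minimally_tough_def)
  have nc: "\<not> complete_graph G" using tough by (auto simp: toughness_def)
  interpret claw_free_graph "gverts G" "gedges G"
  proof
    show "finite (gverts G)" using assms(1) by (simp add: simple_graph_def)
    show "e \<subseteq> gverts G \<and> card e = 2" if "e \<in> gedges G" for e
      using assms(1) that by (simp add: simple_graph_def)
  qed (rule claw_free_adjacent[OF assms(1,3)])
  have comps: "partition_on (gverts G - S) (graph_components (delete_verts G S))" for S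
    using partition_graph_components[of "delete_verts G S"] by simp
  have sep: "separated (graph_components (delete_verts G S))" for S
    unfolding separated_def
  proof (intro ballI impI)
    let ?H = "delete_verts G S"
    fix C D x y assume *: "C \<in> graph_components ?H" "D \<in> graph_components ?H" "C \<noteq> D" "x \<in> C" "y \<in> D"
    then have "x \<in> gverts G - S" "y \<in> gverts G - S" using partition_onD1[OF comps] by blast+
    then show "{x, y} \<notin> gedges G"
      using adjacent_same_component[OF *(1,2,4,5)] *(3) by (auto simp: gedges_delete_verts)
  qed
  interpret three_connected_claw_free_graph "gverts G" "gedges G"
  proof
    fix X assume X: "X \<subseteq> gverts G" "X \<noteq> {}" "gverts G - X - N X \<noteq> {}"
    let ?H = "delete_verts G (N X)"
    obtain x y where xy: "x \<in> X" "y \<in> gverts G" "y \<notin> X" "y \<notin> N X" using X by blast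
    \<comment> \<open>Removing \<open>N X\<close> separates \<open>x\<close> from \<open>y\<close>;
      a ratio of at least 3/2 with two or more components requires three removed vertices.\<close>
    have two: "2 \<le> num_components ?H"
    proof (rule two_components[where x = x and X = X and y = y])
      show "finite (gverts ?H)" using finite_V by simp
      show "b \<in> X" if "a \<in> X" "{a, b} \<in> gedges ?H" for a b
        using that in_N_iff[of b X] by (auto simp: gedges_delete_verts)
      show "x \<in> gverts ?H" using xy X in_N_iff[of x X] by auto
    qed (use xy in auto)
    have "ereal (3 / 2) \<le> ereal (real (card (N X)) / real (num_components ?H))"
      using toughness_le[OF assms(1) nc _ two] N_subset[of X] tough by auto
    then show "3 \<le> card (N X)" using two by (simp add: field_simps)
  qed
  obtain S where S: "S \<subseteq> gverts G" "2 \<le> num_components (delete_verts G S)"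
    "toughness G = ereal (real (card S) / real (num_components (delete_verts G S)))"
    using toughness_attained[OF assms(1) nc] .
  \<comment> \<open>A set attaining the toughness is the equality case of the double count, which
    provides a fragment.\<close>
  have "2 * real (card S) = 3 * real (num_components (delete_verts G S))"
    using S(2,3) tough by (simp add: field_simps)
  then have "2 * card S = 3 * num_components (delete_verts G S)" by linarith
  then obtain X where X: "fragment X"
    using separated_partition(2)[OF comps S(1) sep] S(2) by (auto simp: num_components_def)
  obtain F where F: "fragment F" "\<And>X. fragment X \<Longrightarrow> card F \<le> card X"
    using ex_has_least_nat[of fragment X card] X by blast
  interpret critical_atom_graph "gverts G" "gedges G" F
  proof
    show "4 \<le> card (N {x})" if x: "x \<in> gverts G" for x
    proof -
      have "card (N {x}) \<noteq> 3" using no3 x card_incident_edges[of x] by (auto simp: vertex_degree_def)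
      then show ?thesis using card_N_vertex_ge_3[OF X x] by linarith
    qed
  next
    fix u v assume uv: "{u, v} \<in> gedges G"
    let ?G = "delete_edge G {u, v}"
    have simple: "simple_graph ?G" using assms(1) by (auto simp: simple_graph_def delete_edge_def)
    have lt: "toughness ?G < ereal (3 / 2)" using crit[OF uv] .
    then have "\<not> complete_graph ?G" by (auto simp: toughness_def)
    then obtain S where S: "S \<subseteq> gverts ?G" "2 \<le> num_components (delete_verts ?G S)"
      "toughness ?G = ereal (real (card S) / real (num_components (delete_verts ?G S)))"
      using toughness_attained[OF simple] by blast
    let ?H = "delete_verts ?G S"
    have vs: "gverts ?H = gverts G - S" by (simp add: delete_edge_def)
    have "2 * real (card S) < 3 * real (num_components ?H)"
      using S(2,3) lt by (simp add: field_simps)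
    then have "2 * card S < 3 * card (graph_components ?H)" by (simp add: num_components_def)
    moreover have "partition_on (gverts G - S) (graph_components ?H)"
      using partition_graph_components[of ?H] vs by simp
    \<comment> \<open>An edge of \<open>G\<close> that avoids \<open>S\<close> and differs from
      \<open>uv\<close> survives in \<open>?H\<close>, so it cannot join two components.\<close>
    moreover have "{x, y} = {u, v}"
      if "C \<in> graph_components ?H" "D \<in> graph_components ?H" "C \<noteq> D" "x \<in> C" "y \<in> D"
        "{x, y} \<in> gedges G" for C D x y
    proof (rule ccontr)
      assume "{x, y} \<noteq> {u, v}"
      moreover have "x \<in> gverts G - S" "y \<in> gverts G - S"
        using that partition_onD1[OF partition_graph_components[of ?H]] vs by blast+
      ultimately have "{x, y} \<in> gedges ?H"
        using that(6) by (auto simp: gedges_delete_verts delete_edge_def)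
      then show False using adjacent_same_component[OF that(1,2,4,5)] that(3) by blast
    qed
    ultimately show "\<exists>S P. S \<subseteq> gverts G \<and> partition_on (gverts G - S) P \<and> 2 \<le> card P \<and>
        2 * card S < 3 * card P \<and>
        (\<forall>C\<in>P. \<forall>D\<in>P. C \<noteq> D \<longrightarrow> (\<forall>x\<in>C. \<forall>y\<in>D. {x, y} \<in> gedges G \<longrightarrow> {x, y} = {u, v}))"
      using S(1,2) by (intro exI[of _ S] exI[of _ "graph_components ?H"])
        (simp add: num_components_def delete_edge_def)
  qed (use F in auto)
  show False by (rule contradiction)
qed

end
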